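(* Let $D$ be a locally closed subset of $\mathbb{R}^n$ and $F:\overline{D}\rightrightarrows\mathbb{R}^n$ be a uniformly bounded multi-valued mapping with nonempty closed values. For each $k=1,2,\dots$ let $\mathcal{U}^k$ be a $\sigma$-relatively open partition of $D$, let $(\mathcal{U}^k,\mathcal{G}^k)$ be an invariant partial $\frac1k$-approximation of $F$, and suppose that $(\mathcal{U}^{k+1},\mathcal{G}^{k+1})$ is a refinement of $(\mathcal{U}^k,\mathcal{G}^k)$ for all $k=1,2,\dots$. Assume that for each $k$ there exists a quasi-Lyapunov function $w_k:D\to\mathbb{R}$ for $(\mathcal{U}^k,\mathcal{G}^k)$ such that $w_{k_1}\ge w_{k_2}$ on $D$ whenever $k_1\le k_2$. Then for each point $x_0\in D\cap\bigcap_{k=1}^\infty\overline{\bigcup(\mathbf{Green}\,\mathcal{U}^k)}$ there exist $T>0$ and an absolutely continuous function $x:[0,T]\to D$ such that $x(0)=x_0$ and $\dot{x}(t)\in F(x(t))$ for almost every $t\in[0,T]$.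
   Context: Notation. $\overline{\mathbf{B}}$ is the closed unit ball of $\mathbb{R}^n$. A multi-valued mapping $F:\overline{D}\rightrightarrows\mathbb{R}^n$ is uniformly bounded if there is $c>0$ with $\|v\|\le c$ for all $x\in\overline{D}$, $v\in F(x)$. A set is locally closed if it is the intersection of an open set and a closed set. For a family of sets $\mathcal{A}$, $\bigcup\mathcal{A}$ denotes the union of its members. Bouligand tangent cone. For $A\subseteq\mathbb{R}^n$ and $x\in A$, $T^B_A(x)=\{\lim_{n\to\infty}\frac{x_n-x}{t_n}: \{x_n\}\subseteq A,\ x_n\to x,\ t_n\searrow 0\}$. Relatively open partition. A well-ordered family $\mathcal{V}=\{V_\alpha:1\le\alpha<\alpha_0\}$ of subsets of a topological space $X$ is a relatively open partition of $X$ if (i) for every $\alpha$, $V_\alpha$ is contained in $X\setminus\bigcup_{\beta<\alpha}V_\beta$ and is relatively open in it; (ii) $X=\bigcup_{1\le\alpha<\alpha_0}V_\alpha$. Refinement of partitions. For relatively open partitions $\mathcal{V}^1,\mathcal{V}^2$ of $X$, $\mathcal{V}^2$ is a refinement of $\mathcal{V}^1$ (written $\mathcal{V}^2\prec\mathcal{V}^1$) if (i) for each $V^2\in\mathcal{V}^2$ there is $V^1\in\mathcal{V}^1$ with $V^2\subseteq V^1$; (ii) if $\mathcal{V}^2\ni V^2_{\beta_i}\subseteq V^1_{\alpha_i}\in\mathcal{V}^1$, $i=1,2$, with $\alpha_1<\alpha_2$, then $\beta_1<\beta_2$. Invariant partial $\varepsilon$-approximation. Let $D\subseteq\mathbb{R}^n$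 be locally closed, $F:\overline{D}\rightrightarrows\mathbb{R}^n$ have nonempty values and $\varepsilon>0$. A $\sigma$-relatively open partition of $D$ is a family $\mathcal{U}=\bigcup_{m=1}^\infty\mathcal{U}_m$ where each $\mathcal{U}_m$ is a relatively open partition of $D$. Let $\mathcal{U}$ be such a family with $\mathcal{U}_{m+1}\prec\mathcal{U}_m$ for all $m\in\mathbb{N}$, let $\mathbf{Green}\,\mathcal{U}$ be a (specified) disjoint subfamily of $\mathcal{U}$, and let $\mathcal{G}=\{G_U:U\in\mathbf{Green}\,\mathcal{U}\}$ be a family of multi-valued mappings. Then $(\mathcal{U},\mathcal{G})$ is an invariant partial $\varepsilon$-approximation of $F$ if: (i) if $U\in(\mathbf{Green}\,\mathcal{U})\cap\mathcal{U}_m$ then $U\in\mathcal{U}_k$ for all $k\ge m$; (ii) each $x\in\bigcup(\mathbf{Green}\,\mathcal{U})$ has a neighborhood which intersects at most finitely many elements of $\mathbf{Green}\,\mathcal{U}$; (iii) $\bigcup(\mathbf{Green}\,\mathcal{U})$ is open in $D$; (iv) (a) for each $U\in\mathbf{Green}\,\mathcal{U}$, $G_U:\overline{U}\rightrightarrows\mathbb{R}^n$ is upper semi-continuous with nonempty convex compact values; (b) for each $U\in\mathbf{Green}\,\mathcal{U}$ and $x\in\overline{U}$, $G_U(x)\cap T^B_{\overline{U}}(x)\subseteq F(x)+\varepsilon\overline{\mathbf{B}}$; (c) for each $U\in\mathbf{Green}\,\mathcal{U}$ and $x\in U$, $G_U(x)\cap T^B_U(x)\neq\emptyset$. Order on $\mathbf{Green}\,\mathcal{U}$.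 There is a natural linear order $\prec$ on $\mathbf{Green}\,\mathcal{U}$ inherited from the well-orders of the partitions $\mathcal{U}_m$: for distinct $U,V\in\mathbf{Green}\,\mathcal{U}$, both belong to $\mathcal{U}_m$ for all sufficiently large $m$, and $U\prec V$ means that $U$ precedes $V$ in $\mathcal{U}_m$ for such $m$. Refinement of approximations. Let $(\mathcal{U}^i,\mathcal{G}^i)$ be an invariant partial $\varepsilon_i$-approximation of $F$, $i=1,2$. Then $(\mathcal{U}^2,\mathcal{G}^2)$ is a refinement of $(\mathcal{U}^1,\mathcal{G}^1)$ if: (i) $0<\varepsilon_2<\varepsilon_1$; (ii) for each $U^2\in\mathbf{Green}\,\mathcal{U}^2$ there exists $U^1\in\mathbf{Green}\,\mathcal{U}^1$ with $U^2\subseteq U^1$; (iii) if $\mathbf{Green}\,\mathcal{U}^2\ni U^2_i\subseteq U^1_i\in\mathbf{Green}\,\mathcal{U}^1$, $i=1,2$, with $U^1_2\prec U^1_1$, then $U^2_2\prec U^2_1$; (iv) if $\mathbf{Green}\,\mathcal{U}^2\ni U^2\subseteq U^1\in\mathbf{Green}\,\mathcal{U}^1$, then $G_{U^2}(x)\subseteq G_{U^1}(x)$ for each $x\in\overline{U^2}$ (where $G_{U^i}\in\mathcal{G}^i$). Quasi-Lyapunov function. Let $(\mathcal{U},\mathcal{G})$ be an invariant partial $\varepsilon$-approximation of $F$. A function $w:D\to\mathbb{R}$ is a quasi-Lyapunov function for $(\mathcal{U},\mathcal{G})$ if: (i) $w(x)\ge 0$ for all $x\in D$, and $w(x)=0$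 iff $x\notin\bigcup(\mathbf{Green}\,\mathcal{U})$; (ii) $w$ is continuous; (iii) for all $U\in\mathbf{Green}\,\mathcal{U}$ the restriction $w\!\restriction_U$ is smooth, i.e. it is the restriction to $U$ of a smooth function defined on an open set containing $U$ (and $\mathbf{grad}\,w(x)$ for $x\in U$ denotes the gradient of this smooth function at $x$); (iv) for each $U\in\mathbf{Green}\,\mathcal{U}$ and each $x\in U$, $\max_{y\in G_U(x)\cap T^B_U(x)}\langle\mathbf{grad}\,w(x),y\rangle\ge 1$. *)

theory Defs
  imports "HOL-Analysis.Analysis"
begin

definition locally_closed :: "'a::topological_space set \<Rightarrow> bool" where
  "locally_closed D \<longleftrightarrow> (\<exists>A B. open A \<and> closed B \<and> D = A \<inter> B)"

text \<open>
  Multi-valued mappings are set-valued functions on the whole type. A mapping with domain \<open>S\<close> is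
  only ever used at points of \<open>S\<close>.
\<close>

definition uniformly_bounded_on :: "'a set \<Rightarrow> ('a \<Rightarrow> 'b::real_normed_vector set) \<Rightarrow> bool" where
  "uniformly_bounded_on S F \<longleftrightarrow> (\<exists>c>0. \<forall>x\<in>S. \<forall>v\<in>F x. norm v \<le> c)"

definition upper_semicontinuous_on ::
    "'a::topological_space set \<Rightarrow> ('a \<Rightarrow> 'b::topological_space set) \<Rightarrow> bool" where
  "upper_semicontinuous_on S F \<longleftrightarrow>
     (\<forall>x\<in>S. \<forall>V. open V \<and> F x \<subseteq> V \<longrightarrow> (\<forall>\<^sub>F y in at x within S. F y \<subseteq> V))"

definition bouligand_cone :: "'a::real_normed_vector set \<Rightarrow> 'a \<Rightarrow> 'a set" where
  "bouligand_cone A x =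
     {v. \<exists>X t. (\<forall>n. X n \<in> A) \<and> X \<longlonglongrightarrow> x \<and> (\<forall>n. 0 < t n) \<and> decseq t \<and> t \<longlonglongrightarrow> (0::real) \<and>
               (\<lambda>n. (X n - x) /\<^sub>R t n) \<longlonglongrightarrow> v}"

text \<open>
  The family of all \<open>piece \<V> \<alpha>\<close> with \<open>\<alpha> < bound \<V>\<close>. A well-ordered type \<open>'i\<close> plays the role of the
  ordinals, and its least element is the first index. Every ordinal is the order type of an
  initial segment of some such \<open>'i\<close>.
\<close>

record ('i, 'a) wo_family =
  bound :: 'i
  piece :: "'i \<Rightarrow> 'a set"

definition members :: "('i::wellorder, 'a) wo_family \<Rightarrow> 'a set set" where
  "members \<V> = piece \<V> ` {..<bound \<V>}"

definition relatively_open_partition ::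
    "'a::topological_space set \<Rightarrow> ('i::wellorder, 'a) wo_family \<Rightarrow> bool" where
  "relatively_open_partition X \<V> \<longleftrightarrow>
     (\<forall>\<alpha> < bound \<V>.
        piece \<V> \<alpha> \<subseteq> X - (\<Union>\<beta><\<alpha>. piece \<V> \<beta>) \<and>
        openin (top_of_set (X - (\<Union>\<beta><\<alpha>. piece \<V> \<beta>))) (piece \<V> \<alpha>)) \<and>
     X = (\<Union>\<alpha> < bound \<V>. piece \<V> \<alpha>)"

text \<open>\<open>partition_refines \<V>2 \<V>1\<close>: \<open>\<V>2\<close> is a refinement of \<open>\<V>1\<close>.\<close>

definition partition_refines ::
    "('i::wellorder, 'a) wo_family \<Rightarrow> ('i, 'a) wo_family \<Rightarrow> bool" where
  "partition_refines \<V>2 \<V>1 \<longleftrightarrow>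
     (\<forall>V2 \<in> members \<V>2. \<exists>V1 \<in> members \<V>1. V2 \<subseteq> V1) \<and>
     (\<forall>\<beta>1 < bound \<V>2. \<forall>\<beta>2 < bound \<V>2. \<forall>\<alpha>1 < bound \<V>1. \<forall>\<alpha>2 < bound \<V>1.
        piece \<V>2 \<beta>1 \<subseteq> piece \<V>1 \<alpha>1 \<and> piece \<V>2 \<beta>2 \<subseteq> piece \<V>1 \<alpha>2 \<and> \<alpha>1 < \<alpha>2 \<longrightarrow> \<beta>1 < \<beta>2)"

text \<open>
  The data of a pair \<open>(\<U>, \<G>)\<close>: the partitions \<open>\<U>\<^sub>m\<close> (for \<open>m \<ge> 1\<close>), the green sets, and the
  mappings \<open>G\<^sub>U\<close>. The entry \<open>part A 0\<close>, and \<open>green_map A U\<close> for \<open>U\<close> not green, are not used.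
\<close>

record ('i, 'a) approximation =
  part :: "nat \<Rightarrow> ('i, 'a) wo_family"
  Green :: "'a set set"
  green_map :: "'a set \<Rightarrow> 'a \<Rightarrow> 'a set"

definition sigma_relatively_open_partition ::
    "'a::topological_space set \<Rightarrow> (nat \<Rightarrow> ('i::wellorder, 'a) wo_family) \<Rightarrow> bool" where
  "sigma_relatively_open_partition D \<U> \<longleftrightarrow> (\<forall>m\<ge>1. relatively_open_partition D (\<U> m))"

definition invariant_partial_approximation ::
    "'a::euclidean_space set \<Rightarrow> ('a \<Rightarrow> 'a set) \<Rightarrow> real \<Rightarrow> ('i::wellorder, 'a) approximation \<Rightarrow> bool"
  where
  "invariant_partial_approximation D F \<epsilon> A \<longleftrightarrow>
     0 < \<epsilon> \<and>
     sigma_relatively_open_partition D (part A) \<and>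
     (\<forall>m\<ge>1. partition_refines (part A (Suc m)) (part A m)) \<and>
     Green A \<subseteq> (\<Union>m\<in>{1..}. members (part A m)) \<and>
     pairwise disjnt (Green A) \<and>
     (\<forall>m\<ge>1. \<forall>U \<in> Green A \<inter> members (part A m). \<forall>k\<ge>m. U \<in> members (part A k)) \<and>
     (\<forall>x \<in> \<Union>(Green A). \<exists>N. open N \<and> x \<in> N \<and> finite {U \<in> Green A. U \<inter> N \<noteq> {}}) \<and>
     openin (top_of_set D) (\<Union>(Green A)) \<and>
     (\<forall>U \<in> Green A.
        upper_semicontinuous_on (closure U) (green_map A U) \<and>
        (\<forall>x \<in> closure U.
           green_map A U x \<noteq> {} \<and> convex (green_map A U x) \<and> compact (green_map A U x))) \<and>
     (\<forall>U \<in> Green A. \<forall>x \<in> closure U.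
        green_map A U x \<inter> bouligand_cone (closure U) x
          \<subseteq> {v + \<epsilon> *\<^sub>R b | v b. v \<in> F x \<and> b \<in> cball 0 1}) \<and>
     (\<forall>U \<in> Green A. \<forall>x \<in> U. green_map A U x \<inter> bouligand_cone U x \<noteq> {})"

definition green_less :: "('i::wellorder, 'a) approximation \<Rightarrow> 'a set \<Rightarrow> 'a set \<Rightarrow> bool" where
  "green_less A U V \<longleftrightarrow>
     U \<in> Green A \<and> V \<in> Green A \<and> U \<noteq> V \<and>
     (\<forall>\<^sub>F m in sequentially.
        \<exists>\<alpha> \<beta>. \<alpha> < \<beta> \<and> \<beta> < bound (part A m) \<and> piece (part A m) \<alpha> = U \<and> piece (part A m) \<beta> = V)"

text \<open>\<open>approximation_refines \<epsilon>2 A2 \<epsilon>1 A1\<close>: the \<open>\<epsilon>2\<close>-approximation \<open>A2\<close> is a refinement of \<open>A1\<close>.\<close>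

definition approximation_refines ::
    "real \<Rightarrow> ('i::wellorder, 'a::topological_space) approximation \<Rightarrow>
     real \<Rightarrow> ('i, 'a) approximation \<Rightarrow> bool" where
  "approximation_refines \<epsilon>2 A2 \<epsilon>1 A1 \<longleftrightarrow>
     0 < \<epsilon>2 \<and> \<epsilon>2 < \<epsilon>1 \<and>
     (\<forall>U2 \<in> Green A2. \<exists>U1 \<in> Green A1. U2 \<subseteq> U1) \<and>
     (\<forall>U \<in> Green A2. \<forall>V \<in> Green A2. \<forall>U' \<in> Green A1. \<forall>V' \<in> Green A1.
        U \<subseteq> U' \<and> V \<subseteq> V' \<and> green_less A1 V' U' \<longrightarrow> green_less A2 V U) \<and>
     (\<forall>U2 \<in> Green A2. \<forall>U1 \<in> Green A1. U2 \<subseteq> U1 \<longrightarrow>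
        (\<forall>x \<in> closure U2. green_map A2 U2 x \<subseteq> green_map A1 U1 x))"

text \<open>
  On an open set \<open>S\<close> the following says that \<open>f\<close> is \<open>n\<close> times continuously differentiable, by
  recursion over all directional derivatives of \<open>f\<close>.
\<close>

primrec times_differentiable_on ::
    "nat \<Rightarrow> 'a::real_normed_vector set \<Rightarrow> ('a \<Rightarrow> 'b::real_normed_vector) \<Rightarrow> bool" where
  "times_differentiable_on 0 S f \<longleftrightarrow> continuous_on S f"
| "times_differentiable_on (Suc n) S f \<longleftrightarrow>
     (\<forall>x\<in>S. f differentiable (at x)) \<and>
     (\<forall>v. times_differentiable_on n S (\<lambda>x. frechet_derivative f (at x) v))"

definition smooth_on :: "'a::euclidean_space set \<Rightarrow> ('a \<Rightarrow> real) \<Rightarrow> bool" where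
  "smooth_on S f \<longleftrightarrow> (\<forall>n. times_differentiable_on n S f)"

text \<open>
  The gradient of the smooth extension \<open>h\<close> at \<open>x \<in> U\<close> may depend on the choice of \<open>h\<close>, but its inner
  product with a vector of \<open>bouligand_cone U x\<close> does not. The last conjunct says that the maximum
  over \<open>green_map A U x \<inter> bouligand_cone U x\<close> is attained, at \<open>y\<close>, and is at least 1.
\<close>

definition quasi_Lyapunov ::
    "'a::euclidean_space set \<Rightarrow> ('i::wellorder, 'a) approximation \<Rightarrow> ('a \<Rightarrow> real) \<Rightarrow> bool" where
  "quasi_Lyapunov D A w \<longleftrightarrow>
     (\<forall>x\<in>D. 0 \<le> w x \<and> (w x = 0 \<longleftrightarrow> x \<notin> \<Union>(Green A))) \<and>
     continuous_on D w \<and>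
     (\<forall>U \<in> Green A. \<exists>W h. open W \<and> U \<subseteq> W \<and> smooth_on W h \<and> (\<forall>x\<in>U. h x = w x) \<and>
        (\<forall>x\<in>U. \<exists>grad. (GDERIV h x :> grad) \<and>
           (\<exists>y \<in> green_map A U x \<inter> bouligand_cone U x.
              (\<forall>z \<in> green_map A U x \<inter> bouligand_cone U x. grad \<bullet> z \<le> grad \<bullet> y) \<and>
              1 \<le> grad \<bullet> y)))"

definition absolutely_continuous_on_interval ::
    "real \<Rightarrow> real \<Rightarrow> (real \<Rightarrow> 'a::metric_space) \<Rightarrow> bool" where
  "absolutely_continuous_on_interval a b f \<longleftrightarrow>
     (\<forall>\<epsilon>>0. \<exists>\<delta>>0. \<forall>(n::nat) s t.
        (\<forall>i<n. a \<le> s i \<and> s i \<le> t i \<and> t i \<le> b) \<and>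
        (\<forall>i<n. \<forall>j<n. i \<noteq> j \<longrightarrow> {s i<..<t i} \<inter> {s j<..<t j} = {}) \<and>
        (\<Sum>i<n. t i - s i) < \<delta> \<longrightarrow>
        (\<Sum>i<n. dist (f (s i)) (f (t i))) < \<epsilon>)"

end

(*
  Euler polygons for the k-th approximation start at points of the green union near x0. A node p
  lying close to a point y of a green set U is sent to a point q of U, reached from y along a vector
  of G_U(y) tangent to U on which w_k increases at rate at least 1. Two monotonicities result: w_k
  grows at least at half the speed of time along the nodes, which keeps them in a compact part of
  the green union and so bounds the step lengths from below; and the green set containing the node
  moves up in the order, since points near y lie in U or in green sets preceding U.

  Let k tend to infinity. A limit curve x of the polygons satisfies w_k(x(t)) >= t/2 for all k, so it
  is green for t > 0. For fixed k the polygons visit only finitely many green sets near x(t), in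
  increasing order, so outside a countable set of times the green set visited is locally constant
  along a subsequence. There every derivative of x lies in G_U(x(t)) and is tangent to the closure of
  U, hence is within 1/k of F(x(t)). A Lipschitz curve being differentiable almost everywhere, the
  theorem follows.
*)
theory Submission
  imports Defs "HOL-Complex_Analysis.Great_Picard"
begin

text \<open>The obstacle is that \<open>F\<close> is assumed neither convex-valued nor
  semicontinuous, so nothing about \<open>F\<close> itself survives a limit of polygons. What
  survives is membership in one mapping \<open>G_U\<close>, which is upper semicontinuous with
  convex compact values; but a vector of \<open>G_U\<close> is known to be close to \<open>F\<close>
  only if it is also tangent to the closure of the same \<open>U\<close>. Both facts are available
  for a limit curve when the approximating nodes stay in one \<open>U\<close> throughout a whole
  time interval, and the order on green sets serves to produce such intervals.

  The point \<open>x0\<close> need not be green, and then every \<open>w_k\<close> vanishes there.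
  Hence no single polygon starts at \<open>x0\<close>: the starting points are green and converge to
  \<open>x0\<close>, and the growth estimate must not depend on the initial value of
  \<open>w_k\<close>.

  Polygons are built with ever finer approximations but read at a fixed level k. Refinement turns
  fine membership, order and mappings into coarse ones, and the inequality between the functions
  \<open>w_k\<close> does the same for the growth estimate.\<close>

subsection \<open>Almost everywhere differentiability of Lipschitz curves\<close>

lemma Lipschitz_real_differentiable_ae:
  fixes f :: "real \<Rightarrow> real"
  assumes lip: "\<And>s t. \<bar>f s - f t\<bar> \<le> L * \<bar>s - t\<bar>"
  shows "negligible {t. \<not> f differentiable (at t)}"
proof -
  have "0 \<le> L" using lip[of 0 1] by auto
  \<comment> \<open>The map \<open>g\<close> is a bi-Lipschitz homeomorphism, so \<open>S \<mapsto> lborel (g ` S)\<close> is absolutely continuous; its density is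
    the derivative of \<open>g\<close> at almost every point, by Lebesgue differentiation.\<close>
  define g where "g t = f t + (L + 1) * t" for t
  have lo: "t - s \<le> g t - g s" and hi: "g t - g s \<le> (2 * L + 1) * (t - s)" if "s \<le> t" for s t
    using lip[of t s] that by (auto simp: g_def algebra_simps abs_if split: if_splits)
  have glip: "norm (g y - g x) \<le> (2 * L + 1) * norm (y - x)" for x y
    using lo[of x y] hi[of x y] lo[of y x] hi[of y x] by (cases "x \<le> y") (auto simp: abs_if algebra_simps)
  have contg: "continuous_on UNIV g"
    by (rule lipschitz_on_continuous_on[of "2 * L + 1"], rule lipschitz_onI)
      (use glip \<open>0 \<le> L\<close> in \<open>auto simp: dist_norm norm_minus_commute\<close>)
  have inj: "inj g"
    by (rule injI) (metis lo diff_le_0_iff_le diff_self linorder_le_cases antisym)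
  have surj: "surj g"
  unfolding surj_def
  proof
    fix y
    let ?a = "min 0 (y - g 0)" and ?b = "max 0 (y - g 0)"
    have "g ?a \<le> y" using lo[of ?a 0] by (auto simp: min_def split: if_splits)
    moreover have "y \<le> g ?b" using lo[of 0 ?b] by (auto simp: max_def split: if_splits)
    moreover have "continuous_on {?a..?b} g" using contg continuous_on_subset by blast
    ultimately obtain x where "g x = y" using IVT'[of g ?a y ?b] by fastforce
    then show "\<exists>x. y = g x" by blast
  qed
  define k where "k = inv g"
  have gk [simp]: "g (k y) = y" and kg [simp]: "k (g x) = x" for x y
    using inj surj by (auto simp: k_def surj_f_inv_f)
  have klip: "norm (k y - k x) \<le> norm (y - x)" for x y
    using lo[of "k x" "k y"] lo[of "k y" "k x"] by (cases "k x \<le> k y") (auto simp: abs_if)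
  have contk: "continuous_on UNIV k"
    by (rule lipschitz_on_continuous_on[of 1], rule lipschitz_onI)
      (use klip in \<open>auto simp: dist_norm norm_minus_commute\<close>)
  have km [measurable]: "k \<in> borel_measurable borel"
    using contk by (rule borel_measurable_continuous_onI)
  have vim: "k -` S = g ` S" for S
    by (auto simp: image_iff) (metis gk)
  define \<mu> where "\<mu> = distr lborel borel k"
  have "absolutely_continuous lborel \<mu>"
    unfolding absolutely_continuous_def
  proof
    fix S :: "real set" assume S: "S \<in> null_sets lborel"
    then have Sb: "S \<in> sets borel" by auto
    have "negligible S"
      using S null_sets_completionI negligible_iff_null_sets by blast
    then have "negligible (g ` S)"
      by (rule negligible_locally_Lipschitz_image[of S g, rotated])
        (auto intro!: exI[of _ UNIV] exI[of _ "2 * L + 1"] simp del: real_norm_def intro: glip)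
    then have "k -` S \<in> null_sets lebesgue" by (simp add: vim negligible_iff_null_sets)
    moreover have "k -` S \<in> sets borel" using measurable_sets[OF km Sb] by simp
    ultimately have "emeasure lborel (k -` S) = 0"
      by (simp add: null_sets_completion_iff null_setsD1)
    then show "S \<in> null_sets \<mu>"
      using Sb by (auto simp: \<mu>_def null_sets_def emeasure_distr)
  qed
  moreover have "sets \<mu> = sets lborel" by (simp add: \<mu>_def)
  ultimately obtain \<phi> where \<phi> [measurable]: "\<phi> \<in> borel_measurable lborel" and d: "density lborel \<phi> = \<mu>"
    using sigma_finite_measure.Radon_Nikodym[OF lborel.sigma_finite_measure_axioms] by blast
  have int: "(\<integral>\<^sup>+x. \<phi> x * indicator {a..b} x \<partial>lborel) = ennreal (g b - g a)" if "a \<le> b" for a b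
  proof -
    have "k -` {a..b} = {g a..g b}"
    proof (intro set_eqI iffI)
      fix y assume "y \<in> k -` {a..b}"
      then show "y \<in> {g a..g b}" using lo[of a "k y"] lo[of "k y" b] by auto
    next
      fix y assume "y \<in> {g a..g b}"
      then show "y \<in> k -` {a..b}" using lo[of "k y" a] lo[of b "k y"] by (auto simp: not_le[symmetric]) force+
    qed
    moreover have "g a \<le> g b" using lo[OF that] that by auto
    ultimately have "emeasure \<mu> {a..b} = ennreal (g b - g a)"
      by (simp add: \<mu>_def emeasure_distr)
    then show ?thesis by (simp add: d[symmetric] emeasure_density)
  qed
  \<comment> \<open>Finite integrals over all \<open>{-n..n}\<close> make the density finite almost
    everywhere, so that it can be replaced by the real function \<open>\<psi>\<close> below and
    integrated over intervals.\<close>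
  have "AE x in lborel. \<forall>n::nat. \<phi> x * indicator {-real n..real n} x \<noteq> \<infinity>"
    unfolding AE_all_countable
    by (intro allI nn_integral_PInf_AE) (auto simp: int)
  then have fin: "AE x in lborel. ennreal (enn2real (\<phi> x)) = \<phi> x"
  proof eventually_elim
    case (elim x)
    obtain n :: nat where "\<bar>x\<bar> \<le> real n" using real_arch_simple by blast
    then have "x \<in> {-real n..real n}" by auto
    with elim have "\<phi> x \<noteq> \<infinity>" by (metis indicator_simps(1) mult.right_neutral)
    then show ?case by (simp add: less_top)
  qed
  define \<psi> where "\<psi> x = enn2real (\<phi> x)" for x
  have hi: "(\<psi> has_integral (g b - g a)) {a..b}" if "a \<le> b" for a b
  proof -
    have "(\<integral>\<^sup>+x. ennreal (\<psi> x * indicator {a..b} x) \<partial>lborel) = (\<integral>\<^sup>+x. \<phi> x * indicator {a..b} x \<partial>lborel)"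
      by (rule nn_integral_cong_AE) (use fin in \<open>eventually_elim, auto simp: \<psi>_def indicator_def\<close>)
    with int[OF that] have "((\<lambda>x. \<psi> x * indicator {a..b} x) has_integral (g b - g a)) UNIV"
      by (intro nn_integral_has_integral) (use lo[OF that] that in \<open>auto simp: \<psi>_def\<close>)
    moreover have "(\<lambda>x. \<psi> x * indicator {a..b} x) = (\<lambda>x. if x \<in> {a..b} then \<psi> x else 0)"
      by (auto simp: indicator_def)
    ultimately show ?thesis using has_integral_restrict_UNIV[of "{a..b}" \<psi>] by simp
  qed
  \<comment> \<open>The differentiation theorem averages over intervals to the right of a point and
    thus yields right difference quotients of \<open>g\<close>. Left quotients at \<open>x\<close>
    are right averages of the reflected density at \<open>-x\<close>; this is why the reflection of
    \<open>N2\<close> enters the exceptional set.\<close>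
  have hi': "((\<lambda>x. \<psi> (- x)) has_integral (g (-a) - g (-b))) {a..b}" if "a \<le> b" for a b
    using hi[of "-b" "-a"] that has_integral_reflect_real[of \<psi> "g (-a) - g (-b)" "-a" "-b"] by simp
  have inthi: "\<psi> integrable_on cbox a b" for a b
    by (cases "a \<le> b") (use hi in \<open>auto simp: integrable_on_def\<close>)
  have inthi': "(\<lambda>x. \<psi> (- x)) integrable_on cbox a b" for a b
    by (cases "a \<le> b") (use hi' in \<open>auto simp: integrable_on_def\<close>)
  obtain N1 where N1: "negligible N1" "\<And>x e. \<lbrakk>x \<notin> N1; 0 < e\<rbrakk> \<Longrightarrow> \<exists>d>0. \<forall>h. 0 < h \<and> h < d \<longrightarrow>
        norm (integral (cbox x (x + h *\<^sub>R One)) \<psi> /\<^sub>R h ^ DIM(real) - \<psi> x) < e"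
    by (rule integrable_ccontinuous_explicit[OF inthi])
      blast
  obtain N2 where N2: "negligible N2" "\<And>x e. \<lbrakk>x \<notin> N2; 0 < e\<rbrakk> \<Longrightarrow> \<exists>d>0. \<forall>h. 0 < h \<and> h < d \<longrightarrow>
        norm (integral (cbox x (x + h *\<^sub>R One)) (\<lambda>x. \<psi> (-x)) /\<^sub>R h ^ DIM(real) - \<psi> (-x)) < e"
    by (rule integrable_ccontinuous_explicit[OF inthi'])
      blast
  have "f differentiable (at x)" if "x \<notin> N1 \<union> uminus ` N2" for x
  proof -
    have "(g has_real_derivative \<psi> x) (at x)"
      unfolding has_field_derivative_iff LIM_eq
    proof (intro allI impI)
      fix e :: real assume "0 < e"
      have x1: "x \<notin> N1" and x2: "-x \<notin> N2" using that by (auto simp: image_iff)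
      obtain d1 where d1: "d1 > 0" "\<forall>h. 0 < h \<and> h < d1 \<longrightarrow>
          norm (integral (cbox x (x + h *\<^sub>R One)) \<psi> /\<^sub>R h ^ DIM(real) - \<psi> x) < e"
        using N1(2)[OF x1 \<open>0 < e\<close>] by blast
      have d1': "\<bar>(g (x + h) - g x) / h - \<psi> x\<bar> < e" if "0 < h" "h < d1" for h
        using d1(2)[rule_format, of h] that integral_unique[OF hi[of x "x + h"]] by (simp add: divide_inverse mult.commute) 
      obtain d2 where d2: "d2 > 0" "\<forall>h. 0 < h \<and> h < d2 \<longrightarrow>
          norm (integral (cbox (-x) ((-x) + h *\<^sub>R One)) (\<lambda>x. \<psi> (- x)) /\<^sub>R h ^ DIM(real) - \<psi> (- (- x))) < e"
        using N2(2)[OF x2 \<open>0 < e\<close>] by blast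
      have d2': "\<bar>(g x - g (x - h)) / h - \<psi> x\<bar> < e" if "0 < h" "h < d2" for h
        using d2(2)[rule_format, of h] that integral_unique[OF hi'[of "-x" "-x + h"]] by (simp add: divide_inverse mult.commute)
      show "\<exists>s>0. \<forall>y. y \<noteq> x \<and> norm (y - x) < s \<longrightarrow> norm ((g y - g x) / (y - x) - \<psi> x) < e"
      proof (intro exI[of _ "min d1 d2"] conjI allI impI)
        fix y assume y: "y \<noteq> x \<and> norm (y - x) < min d1 d2"
        show "norm ((g y - g x) / (y - x) - \<psi> x) < e"
        proof (cases "x < y")
          case True
          then show ?thesis using d1'[of "y - x"] y by auto
        next
          case False
          then have "(g x - g y) / (x - y) = (g y - g x) / (y - x)"
            by (metis minus_diff_eq minus_divide_divide)
          then show ?thesis using d2'[of "x - y"] y False by auto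
        qed
      qed (use d1 d2 in auto)
    qed
    then have "((\<lambda>t. g t - (L + 1) * t) has_real_derivative (\<psi> x - (L + 1))) (at x)"
      by (auto intro!: derivative_eq_intros)
    moreover have "(\<lambda>t. g t - (L + 1) * t) = f" by (auto simp: g_def)
    ultimately show ?thesis using real_differentiable_def by auto
  qed
  moreover have "negligible (N1 \<union> uminus ` N2)"
    
  proof (rule negligible_Un)
    show "negligible (uminus ` N2)"
      by (rule negligible_locally_Lipschitz_image[OF _ N2(1)])
        (simp, intro exI[of _ UNIV] exI[of _ 1], auto)
  qed (fact N1(1))
  ultimately show ?thesis
    by (metis (mono_tags, lifting) mem_Collect_eq negligible_subset subsetI)
qed

lemma Lipschitz_differentiable_ae:
  fixes f :: "real \<Rightarrow> 'a::euclidean_space"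
  assumes lip: "L-lipschitz_on UNIV f"
  shows "negligible {t. \<not> f differentiable (at t)}"
proof -
  have "negligible {t. \<not> (\<lambda>t. f t \<bullet> b) differentiable (at t)}" if "b \<in> Basis" for b
  proof (rule Lipschitz_real_differentiable_ae)
    fix s t
    have "\<bar>f s \<bullet> b - f t \<bullet> b\<bar> \<le> norm (f s - f t)"
      using Basis_le_norm[OF that, of "f s - f t"] by (simp add: inner_diff_left)
    also have "\<dots> \<le> L * \<bar>s - t\<bar>" using lipschitz_onD[OF lip, of s t] by (simp add: dist_norm)
    finally show "\<bar>f s \<bullet> b - f t \<bullet> b\<bar> \<le> L * \<bar>s - t\<bar>" .
  qed
  then have "negligible (\<Union>b\<in>Basis. {t. \<not> (\<lambda>t. f t \<bullet> b) differentiable (at t)})"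
    by (intro negligible_Union) auto
  moreover have "{t. \<not> f differentiable (at t)} \<subseteq> (\<Union>b\<in>Basis. {t. \<not> (\<lambda>t. f t \<bullet> b) differentiable (at t)})"
    using differentiable_componentwise_within[of f _ UNIV] by auto
  ultimately show ?thesis by (rule negligible_subset)
qed

subsection \<open>The order of the green sets\<close>

lemma relatively_open_partition_unique:
  assumes V: "relatively_open_partition X V"
    and "\<alpha> < bound V" "\<beta> < bound V" "x \<in> piece V \<alpha>" "x \<in> piece V \<beta>"
  shows "\<alpha> = \<beta>"
proof (rule linorder_cases[of \<alpha> \<beta>])
  have *: "piece V \<gamma> \<subseteq> X - (\<Union>\<delta><\<gamma>. piece V \<delta>)" if "\<gamma> < bound V" for \<gamma>
    using V that unfolding relatively_open_partition_def by blast
  show "\<alpha> = \<beta>" if "\<alpha> < \<beta>" using *[of \<beta>] assms that by blast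
  show "\<alpha> = \<beta>" if "\<beta> < \<alpha>" using *[of \<alpha>] assms that by blast
qed

text \<open>A piece is open only relative to what the earlier pieces leave over. Writing it as
  \<open>X - W\<close> intersected with an open \<open>T\<close>, where \<open>W\<close> is the
  union of the earlier pieces, its union with \<open>W\<close> equals \<open>W\<close> together with
  \<open>X \<inter> T\<close>, so the restriction disappears.\<close>

lemma relatively_open_partition_openin_initial:
  assumes V: "relatively_open_partition X V" and "\<alpha> < bound V"
  shows "openin (top_of_set X) (\<Union>\<beta>\<le>\<alpha>. piece V \<beta>)"
  using \<open>\<alpha> < bound V\<close>
proof (induction \<alpha> rule: less_induct)
  case (less \<alpha>)
  let ?W = "\<Union>\<beta><\<alpha>. piece V \<beta>"
  \<comment> \<open>As a union of closed initial segments, \<open>W\<close> is open by the induction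
    hypothesis; successor and limit indices need no separate treatment.\<close>
  have "?W = (\<Union>\<beta><\<alpha>. \<Union>\<gamma>\<le>\<beta>. piece V \<gamma>)"
    by (auto intro: le_less_trans)
  also have "openin (top_of_set X) \<dots>"
    using less by (intro openin_Union) (auto intro: less_trans)
  finally have W: "openin (top_of_set X) ?W" .
  have "openin (top_of_set (X - ?W)) (piece V \<alpha>)"
    using V less.prems unfolding relatively_open_partition_def by blast
  then obtain T where T: "open T" "piece V \<alpha> = (X - ?W) \<inter> T"
    by (auto simp: openin_open)
  have "?W \<subseteq> X" using W openin_imp_subset by blast
  moreover have "{..\<alpha>} = insert \<alpha> {..<\<alpha>}" by auto
  then have "(\<Union>\<beta>\<le>\<alpha>. piece V \<beta>) = piece V \<alpha> \<union> ?W" by simp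
  ultimately have "(\<Union>\<beta>\<le>\<alpha>. piece V \<beta>) = ?W \<union> (X \<inter> T)"
    using T(2) by auto
  with W T(1) show ?case by (simp add: openin_Un openin_open_Int)
qed

lemma partition_refines_less:
  assumes "partition_refines V2 V1"
    and "\<beta>\<^sub>1 < bound V2" "\<beta>\<^sub>2 < bound V2" "\<alpha>\<^sub>1 < bound V1" "\<alpha>\<^sub>2 < bound V1"
    and "piece V2 \<beta>\<^sub>1 \<subseteq> piece V1 \<alpha>\<^sub>1" "piece V2 \<beta>\<^sub>2 \<subseteq> piece V1 \<alpha>\<^sub>2" "\<alpha>\<^sub>1 < \<alpha>\<^sub>2"
  shows "\<beta>\<^sub>1 < \<beta>\<^sub>2"
  by (rule assms(1)[unfolded partition_refines_def, THEN conjunct2, rule_format,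
        OF assms(2-5) conjI[OF assms(6) conjI[OF assms(7,8)]]])

lemma partition_refines_subset:
  assumes "partition_refines V2 V1" "W \<in> members V2"
  obtains \<alpha> where "\<alpha> < bound V1" "W \<subseteq> piece V1 \<alpha>"
proof -
  obtain V where "V \<in> members V1" "W \<subseteq> V"
    using assms(1)[unfolded partition_refines_def, THEN conjunct1] assms(2) by blast
  then show ?thesis using that unfolding members_def by auto
qed

context
  fixes D :: "'a::euclidean_space set" and F \<epsilon> and A :: "('i::wellorder, 'a) approximation"
  assumes A: "invariant_partial_approximation D F \<epsilon> A"
begin

lemma approximation_conjuncts:
  shows "0 < \<epsilon>"
    and "sigma_relatively_open_partition D (part A)"
    and "\<forall>m\<ge>1. partition_refines (part A (Suc m)) (part A m)"
    and "Green A \<subseteq> (\<Union>m\<in>{1..}. members (part A m))"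
    and "pairwise disjnt (Green A)"
    and "\<forall>m\<ge>1. \<forall>U \<in> Green A \<inter> members (part A m). \<forall>k\<ge>m. U \<in> members (part A k)"
    and "\<forall>x \<in> \<Union>(Green A). \<exists>N. open N \<and> x \<in> N \<and> finite {U \<in> Green A. U \<inter> N \<noteq> {}}"
    and "\<forall>U \<in> Green A. upper_semicontinuous_on (closure U) (green_map A U) \<and>
      (\<forall>x \<in> closure U. green_map A U x \<noteq> {} \<and> convex (green_map A U x) \<and> compact (green_map A U x))"
    and "\<forall>U \<in> Green A. \<forall>x \<in> closure U. green_map A U x \<inter> bouligand_cone (closure U) x
      \<subseteq> {v + \<epsilon> *\<^sub>R b | v b. v \<in> F x \<and> b \<in> cball 0 1}"
  by (insert A[unfolded invariant_partial_approximation_def], (elim conjE, assumption)+)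

lemma approximation_partition: "1 \<le> m \<Longrightarrow> relatively_open_partition D (part A m)"
  using approximation_conjuncts(2) unfolding sigma_relatively_open_partition_def by blast

lemma approximation_partition_refines: "1 \<le> m \<Longrightarrow> partition_refines (part A (Suc m)) (part A m)"
  using approximation_conjuncts(3) by blast

lemma green_level: "U \<in> Green A \<Longrightarrow> \<exists>m\<ge>1. U \<in> members (part A m)"
  using approximation_conjuncts(4) by auto

lemmas green_pairwise_disjnt = approximation_conjuncts(5)

lemma green_persistent:
  "U \<in> Green A \<Longrightarrow> 1 \<le> m \<Longrightarrow> U \<in> members (part A m) \<Longrightarrow> m \<le> k \<Longrightarrow> U \<in> members (part A k)"
  using approximation_conjuncts(6) by auto

lemmas green_locally_finite = approximation_conjuncts(7)[rule_format]

lemma green_usc: "U \<in> Green A \<Longrightarrow> upper_semicontinuous_on (closure U) (green_map A U)"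
  using approximation_conjuncts(8) by simp

lemma green_map_convex_compact:
  "U \<in> Green A \<Longrightarrow> x \<in> closure U \<Longrightarrow>
    green_map A U x \<noteq> {} \<and> convex (green_map A U x) \<and> compact (green_map A U x)"
  using approximation_conjuncts(8) by simp

lemma green_map_cone_approx:
  assumes "U \<in> Green A" "x \<in> closure U" "v \<in> green_map A U x" "v \<in> bouligand_cone (closure U) x"
  shows "\<exists>u\<in>F x. dist v u \<le> \<epsilon>"
proof -
  have "v \<in> {v + \<epsilon> *\<^sub>R b | v b. v \<in> F x \<and> b \<in> cball 0 1}"
    using approximation_conjuncts(9) assms by blast
  then obtain u b where "v = u + \<epsilon> *\<^sub>R b" "u \<in> F x" "norm b \<le> 1" by auto
  then show ?thesis
    using approximation_conjuncts(1) by (intro bexI[of _ u]) (auto simp: dist_norm mult_left_le)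
qed

lemma green_subset: "U \<in> Green A \<Longrightarrow> U \<subseteq> D"
proof -
  assume "U \<in> Green A"
  then obtain m where "1 \<le> m" "U \<in> members (part A m)" using green_level by blast
  then show ?thesis
    using approximation_partition[of m] unfolding relatively_open_partition_def members_def by blast
qed

lemma green_common_level:
  assumes "U \<in> Green A" "V \<in> Green A"
  shows "\<exists>m\<ge>1. U \<in> members (part A m) \<and> V \<in> members (part A m)"
proof -
  obtain m where "1 \<le> m" "U \<in> members (part A m)" using green_level assms(1) by blast
  moreover obtain n where "1 \<le> n" "V \<in> members (part A n)" using green_level assms(2) by blast
  ultimately show ?thesis
    using green_persistent[OF assms(1), of m "max m n"] green_persistent[OF assms(2), of n "max m n"]
    by (intro exI[of _ "max m n"]) simp
qed

text \<open>Comparison at one level decides the order. Green sets persist at later levels, and the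
  order clause of partition refinement, applied to the trivial inclusions of \<open>U\<close> and
  \<open>V\<close> in themselves, carries the comparison upwards. A point of \<open>U\<close>
  excludes \<open>U = V\<close>, since it would lie in two pieces.\<close>

lemma green_lessI:
  assumes "U \<in> Green A" "V \<in> Green A" "U \<noteq> {}" "1 \<le> m" "\<alpha> < \<beta>" "\<beta> < bound (part A m)"
    and "piece (part A m) \<alpha> = U" "piece (part A m) \<beta> = V"
  shows "green_less A U V"
proof -
  have UV: "U \<in> members (part A m)" "V \<in> members (part A m)"
    using assms unfolding members_def by auto
  have *: "\<exists>\<alpha> \<beta>. \<alpha> < \<beta> \<and> \<beta> < bound (part A k) \<and> piece (part A k) \<alpha> = U \<and> piece (part A k) \<beta> = V"
    if "m \<le> k" for k
    using that
  proof (induction k rule: dec_induct)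
    case base
    then show ?case using assms by blast
  next
    case (step k)
    then obtain \<alpha> \<beta> where ab: "\<alpha> < \<beta>" "\<beta> < bound (part A k)" "piece (part A k) \<alpha> = U" "piece (part A k) \<beta> = V"
      by blast
    have "1 \<le> k" using step assms by linarith
    have "U \<in> members (part A (Suc k))" "V \<in> members (part A (Suc k))"
      using green_persistent[OF assms(1) \<open>1 \<le> m\<close> UV(1)] green_persistent[OF assms(2) \<open>1 \<le> m\<close> UV(2)] step by auto
    then obtain \<alpha>' \<beta>' where ab': "\<alpha>' < bound (part A (Suc k))" "\<beta>' < bound (part A (Suc k))"
        "piece (part A (Suc k)) \<alpha>' = U" "piece (part A (Suc k)) \<beta>' = V"
      unfolding members_def by auto
    have "\<alpha> < bound (part A k)" using ab by (meson less_trans)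
    then have "\<alpha>' < \<beta>'"
      using partition_refines_less[OF approximation_partition_refines[OF \<open>1 \<le> k\<close>] ab'(1,2), of \<alpha> \<beta>] ab ab' by simp
    with ab' show ?case by blast
  qed
  have "U \<noteq> V"
  proof
    assume "U = V"
    then obtain x where "x \<in> piece (part A m) \<alpha>" "x \<in> piece (part A m) \<beta>" using assms by blast
    moreover have "\<alpha> < bound (part A m)" using assms by (meson less_trans)
    ultimately have "\<alpha> = \<beta>"
      using relatively_open_partition_unique[OF approximation_partition[OF \<open>1 \<le> m\<close>]] assms by blast
    then show False using \<open>\<alpha> < \<beta>\<close> by simp
  qed
  with * show ?thesis
    unfolding green_less_def eventually_sequentially using assms(1,2) by blast
qed

lemma green_less_linear:
  assumes "U \<in> Green A" "V \<in> Green A" "U \<noteq> {}" "V \<noteq> {}"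
  shows "U = V \<or> green_less A U V \<or> green_less A V U"
proof -
  obtain m where m: "1 \<le> m" "U \<in> members (part A m)" "V \<in> members (part A m)"
    using green_common_level assms by blast
  then obtain \<alpha> \<beta> where ab: "\<alpha> < bound (part A m)" "\<beta> < bound (part A m)"
      "piece (part A m) \<alpha> = U" "piece (part A m) \<beta> = V"
    unfolding members_def by auto
  show ?thesis
    using linorder_cases[of \<alpha> \<beta>] green_lessI[of U V m \<alpha> \<beta>] green_lessI[of V U m \<beta> \<alpha>] assms m ab by blast
qed

lemma green_less_trans:
  assumes "green_less A U V" "green_less A V W" "V \<noteq> {}" "U \<noteq> {}"
  shows "green_less A U W"
proof -
  let ?P = "\<lambda>U V m. \<exists>\<alpha> \<beta>. \<alpha> < \<beta> \<and> \<beta> < bound (part A m) \<and> piece (part A m) \<alpha> = U \<and> piece (part A m) \<beta> = V"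
  have "\<forall>\<^sub>F m in sequentially. ?P U V m \<and> ?P V W m \<and> 1 \<le> m"
    using assms eventually_ge_at_top[of 1] unfolding green_less_def by (intro eventually_conj) blast+
  then obtain m where "?P U V m" "?P V W m" "1 \<le> m"
    using eventually_happens'[OF sequentially_bot] by blast
  then obtain \<alpha> \<beta> \<beta>' \<gamma> where ab: "\<alpha> < \<beta>" "\<beta> < bound (part A m)" "piece (part A m) \<alpha> = U" "piece (part A m) \<beta> = V"
     "\<beta>' < \<gamma>" "\<gamma> < bound (part A m)" "piece (part A m) \<beta>' = V" "piece (part A m) \<gamma> = W" by blast
  obtain x where "x \<in> V" using assms by blast
  moreover have "\<beta>' < bound (part A m)" using ab by (meson less_trans)
  ultimately have "\<beta> = \<beta>'"
    using relatively_open_partition_unique[OF approximation_partition[OF \<open>1 \<le> m\<close>], of \<beta> \<beta>' x] ab by simp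
  then have "\<alpha> < \<gamma>" using ab by (meson less_trans)
  moreover have "U \<in> Green A" "W \<in> Green A" using assms unfolding green_less_def by blast+
  ultimately show ?thesis using green_lessI[of U W m \<alpha> \<gamma>] ab \<open>1 \<le> m\<close> assms by blast
qed

lemma green_less_asym:
  assumes "green_less A U V" "V \<noteq> {}" "U \<noteq> {}"
  shows "\<not> green_less A V U"
proof
  assume "green_less A V U"
  then have "green_less A U U" using green_less_trans assms by blast
  then show False unfolding green_less_def by blast
qed

text \<open>At a level containing \<open>U\<close> the union of all pieces up to \<open>U\<close> is
  open in \<open>D\<close>, so a point \<open>p\<close> near \<open>y\<close> lies in a piece that
  does not come after \<open>U\<close>. It remains to transfer this from the piece to the green set
  \<open>V\<close> of \<open>p\<close>.\<close>

lemma green_initial_neighbourhood: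
  assumes U: "U \<in> Green A" and y: "y \<in> U"
  shows "\<exists>\<rho>>0. \<forall>V\<in>Green A. \<forall>p\<in>V. dist p y < \<rho> \<longrightarrow> V = U \<or> green_less A V U"
proof -
  obtain m where m: "1 \<le> m" "U \<in> members (part A m)" using green_level[OF U] by blast
  then obtain \<alpha> where \<alpha>: "\<alpha> < bound (part A m)" "piece (part A m) \<alpha> = U"
    unfolding members_def by auto
  have "y \<in> (\<Union>\<beta>\<le>\<alpha>. piece (part A m) \<beta>)" using \<alpha> y by blast
  then obtain \<rho> where \<rho>: "\<rho> > 0" "ball y \<rho> \<inter> D \<subseteq> (\<Union>\<beta>\<le>\<alpha>. piece (part A m) \<beta>)"
    using relatively_open_partition_openin_initial[OF approximation_partition[OF m(1)] \<alpha>(1)]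
    unfolding openin_contains_ball by meson
  have "V = U \<or> green_less A V U" if V: "V \<in> Green A" and p: "p \<in> V" "dist p y < \<rho>" for V p
  proof -
    have "p \<in> D" using green_subset[OF V] p by blast
    then obtain \<beta> where \<beta>: "\<beta> \<le> \<alpha>" "p \<in> piece (part A m) \<beta>"
    proof -
      have "p \<in> ball y \<rho> \<inter> D" using \<open>p \<in> D\<close> p by (simp add: dist_commute)
      then show ?thesis using \<rho>(2) that by blast
    qed
    show ?thesis
    proof (cases "\<beta> = \<alpha>")
      case True
      then have "p \<in> U" using \<beta> \<alpha> by simp
      then show ?thesis
        using green_pairwise_disjnt U V p unfolding pairwise_def disjnt_def by blast
    next
      case False
      have \<beta>b: "\<beta> < bound (part A m)" using \<beta> \<alpha> by (meson le_less_trans)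
      obtain k where k: "m \<le> k" "U \<in> members (part A k)" "V \<in> members (part A k)"
      proof -
        obtain n where "1 \<le> n" "V \<in> members (part A n)" using green_level V by blast
        then show ?thesis
          using that[of "max m n"] green_persistent[OF U m, of "max m n"]
            green_persistent[OF V, of n "max m n"] by simp
      qed
      \<comment> \<open>\<open>V\<close> need not be a piece at level m. The piece containing
        \<open>p\<close> is therefore followed to a level where both \<open>U\<close> and
        \<open>V\<close> occur: refinement puts the new piece of \<open>p\<close> inside the old one
        and so keeps it before \<open>U\<close>.\<close>
      have ord: "\<exists>\<gamma>\<^sub>1 \<gamma>\<^sub>2. \<gamma>\<^sub>1 < \<gamma>\<^sub>2 \<and> \<gamma>\<^sub>2 < bound (part A k') \<and> p \<in> piece (part A k') \<gamma>\<^sub>1 \<and> piece (part A k') \<gamma>\<^sub>2 = U"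
        if "m \<le> k'" for k'
        using that
      proof (induction k' rule: dec_induct)
        case base
        then show ?case using \<alpha> \<beta> False by (intro exI[of _ \<beta>] exI[of _ \<alpha>]) auto
      next
        case (step n)
        then obtain \<gamma>\<^sub>1 \<gamma>\<^sub>2 where g: "\<gamma>\<^sub>1 < \<gamma>\<^sub>2" "\<gamma>\<^sub>2 < bound (part A n)" "p \<in> piece (part A n) \<gamma>\<^sub>1" "piece (part A n) \<gamma>\<^sub>2 = U"
          by blast
        have n: "1 \<le> n" "1 \<le> Suc n" using step m by linarith+
        have g1: "\<gamma>\<^sub>1 < bound (part A n)" using g by (meson less_trans)
        obtain \<delta>\<^sub>1 where d1: "\<delta>\<^sub>1 < bound (part A (Suc n))" "p \<in> piece (part A (Suc n)) \<delta>\<^sub>1"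
          using approximation_partition[OF n(2)] \<open>p \<in> D\<close> unfolding relatively_open_partition_def by blast
        have "U \<in> members (part A (Suc n))"
          using green_persistent[OF U m, of "Suc n"] step by auto
        then obtain \<delta>\<^sub>2 where d2: "\<delta>\<^sub>2 < bound (part A (Suc n))" "piece (part A (Suc n)) \<delta>\<^sub>2 = U"
          unfolding members_def by auto
        have "piece (part A (Suc n)) \<delta>\<^sub>1 \<in> members (part A (Suc n))"
          using d1 unfolding members_def by auto
        then obtain \<eta> where \<eta>: "\<eta> < bound (part A n)" "piece (part A (Suc n)) \<delta>\<^sub>1 \<subseteq> piece (part A n) \<eta>"
          using partition_refines_subset[OF approximation_partition_refines[OF n(1)]] by blast
        then have "\<eta> = \<gamma>\<^sub>1"
          using relatively_open_partition_unique[OF approximation_partition[OF n(1)], of \<eta> \<gamma>\<^sub>1 p] g g1 d1 by blast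
        then have "\<delta>\<^sub>1 < \<delta>\<^sub>2"
          using partition_refines_less[OF approximation_partition_refines[OF n(1)] d1(1) d2(1) g1 g(2)] g(1,4) d2(2) \<eta>(2)
          by simp
        then show ?case using d1 d2 by blast
      qed
      from ord[OF k(1)] obtain \<gamma>\<^sub>1 \<gamma>\<^sub>2 where g: "\<gamma>\<^sub>1 < \<gamma>\<^sub>2" "\<gamma>\<^sub>2 < bound (part A k)" "p \<in> piece (part A k) \<gamma>\<^sub>1" "piece (part A k) \<gamma>\<^sub>2 = U"
        by blast
      have k1: "1 \<le> k" using m k by linarith
      obtain \<delta> where \<delta>: "\<delta> < bound (part A k)" "piece (part A k) \<delta> = V"
        using k(3) unfolding members_def by auto
      have "\<gamma>\<^sub>1 < bound (part A k)" using g by (meson less_trans)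
      then have "\<delta> = \<gamma>\<^sub>1"
        using relatively_open_partition_unique[OF approximation_partition[OF k1], of \<delta> \<gamma>\<^sub>1 p] g \<delta> p by blast
      moreover have "V \<noteq> {}" using p by blast
      ultimately have "green_less A V U"
        using green_lessI[of V U k \<delta> \<gamma>\<^sub>2] U V k1 g \<delta> by blast
      then show ?thesis by blast
    qed
  qed
  with \<rho>(1) show ?thesis by blast
qed

end

section \<open>Green sets indexed by their points, and iterated refinement\<close>

definition green_of :: "('i, 'a) approximation \<Rightarrow> 'a \<Rightarrow> 'a set" where
  "green_of A x = (THE U. U \<in> Green A \<and> x \<in> U)"

text \<open>Comparing green points instead of green sets keeps the empty set out: it may be green
  and may occur at several indices of a partition, whereas the order laws above are established for
  nonempty sets.\<close>

definition green_le :: "('i::wellorder, 'a) approximation \<Rightarrow> 'a \<Rightarrow> 'a \<Rightarrow> bool" where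
  "green_le A x y \<longleftrightarrow> green_of A x = green_of A y \<or> green_less A (green_of A x) (green_of A y)"

lemma green_of_eq:
  assumes "invariant_partial_approximation D F \<epsilon> A" "U \<in> Green A" "x \<in> U"
  shows "green_of A x = U"
  unfolding green_of_def
  by (rule the_equality)
    (use assms green_pairwise_disjnt[OF assms(1)] in \<open>auto simp: pairwise_def disjnt_def\<close>)

lemma green_of:
  assumes "invariant_partial_approximation D F \<epsilon> A" "x \<in> \<Union>(Green A)"
  shows "green_of A x \<in> Green A" "x \<in> green_of A x"
  using green_of_eq[OF assms(1)] assms(2) by auto

lemma green_le_trans:
  assumes A: "invariant_partial_approximation D F \<epsilon> A"
    and "x \<in> \<Union>(Green A)" "y \<in> \<Union>(Green A)" "green_le A x y" "green_le A y z"
  shows "green_le A x z"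
proof -
  have "green_of A x \<noteq> {}" "green_of A y \<noteq> {}" using green_of[OF A] assms by blast+
  then show ?thesis using assms(4,5) green_less_trans[OF A] unfolding green_le_def by metis
qed

text \<open>The clauses of a refinement, for nonempty green sets only: in this form they are transitive.\<close>

definition green_refines :: "('i::wellorder, 'a::topological_space) approximation \<Rightarrow> ('i, 'a) approximation \<Rightarrow> bool"
  where "green_refines A2 A1 \<longleftrightarrow>
    (\<forall>x\<in>\<Union>(Green A2). x \<in> \<Union>(Green A1) \<and> green_of A2 x \<subseteq> green_of A1 x \<and>
       (\<forall>z\<in>closure (green_of A2 x). green_map A2 (green_of A2 x) z \<subseteq> green_map A1 (green_of A1 x) z)) \<and>
    (\<forall>x\<in>\<Union>(Green A2). \<forall>y\<in>\<Union>(Green A2). green_le A2 x y \<longrightarrow> green_le A1 x y)"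

lemma green_refines_refl: "green_refines A A"
  unfolding green_refines_def by blast

lemma green_refines_trans: 
  assumes 1: "green_refines A2 A1" and 2: "green_refines A3 A2" shows "green_refines A3 A1"
  unfolding green_refines_def
proof (intro conjI ballI impI)
  fix x assume x: "x \<in> \<Union>(Green A3)"
  then have x2: "x \<in> \<Union>(Green A2)" and s: "green_of A3 x \<subseteq> green_of A2 x"
    and g: "\<And>z. z \<in> closure (green_of A3 x) \<Longrightarrow> green_map A3 (green_of A3 x) z \<subseteq> green_map A2 (green_of A2 x) z"
    using 2 unfolding green_refines_def by blast+
  show "x \<in> \<Union>(Green A1)" and "green_of A3 x \<subseteq> green_of A1 x"
    using 1 x2 s unfolding green_refines_def by blast+
  fix z assume z: "z \<in> closure (green_of A3 x)"
  then have "z \<in> closure (green_of A2 x)" using s closure_mono by blast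
  then show "green_map A3 (green_of A3 x) z \<subseteq> green_map A1 (green_of A1 x) z"
    using 1 x2 g[OF z] unfolding green_refines_def by blast
next
  fix x y assume "x \<in> \<Union>(Green A3)" "y \<in> \<Union>(Green A3)" "green_le A3 x y"
  moreover from this have "x \<in> \<Union>(Green A2)" "y \<in> \<Union>(Green A2)" "green_le A2 x y"
    using 2 unfolding green_refines_def by blast+
  ultimately show "green_le A1 x y" using 1 unfolding green_refines_def by blast
qed

text \<open>Refinement transports the strict order from the coarse to the fine approximation, while
  polygons need the weak order transported from fine to coarse. This is the contrapositive, by
  linearity of the coarse order and asymmetry of the fine one.\<close>

lemma approximation_refines_imp_green_refines:
  assumes A1: "invariant_partial_approximation D F \<epsilon>\<^sub>1 A1"
    and A2: "invariant_partial_approximation D F \<epsilon>\<^sub>2 A2"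
    and r: "approximation_refines \<delta>\<^sub>2 A2 \<delta>\<^sub>1 A1"
  shows "green_refines A2 A1"
  unfolding green_refines_def
proof (intro conjI ballI impI)
  have *: "x \<in> \<Union>(Green A1)" "green_of A2 x \<subseteq> green_of A1 x" if x: "x \<in> \<Union>(Green A2)" for x
  proof -
    obtain U where U: "U \<in> Green A1" "green_of A2 x \<subseteq> U"
      using r[unfolded approximation_refines_def, THEN conjunct2, THEN conjunct2, THEN conjunct1]
        green_of(1)[OF A2 x] by blast
    then have "x \<in> U" using green_of(2)[OF A2 x] by blast
    with U show "x \<in> \<Union>(Green A1)" "green_of A2 x \<subseteq> green_of A1 x"
      using green_of_eq[OF A1] by auto
  qed
  { fix x assume x: "x \<in> \<Union>(Green A2)"
    show "x \<in> \<Union>(Green A1)" "green_of A2 x \<subseteq> green_of A1 x" using *[OF x] .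
    fix z assume "z \<in> closure (green_of A2 x)"
    then show "green_map A2 (green_of A2 x) z \<subseteq> green_map A1 (green_of A1 x) z"
      using r[unfolded approximation_refines_def, THEN conjunct2, THEN conjunct2, THEN conjunct2, THEN conjunct2]
        green_of(1)[OF A2 x] green_of(1)[OF A1 *(1)[OF x]] *(2)[OF x] by blast }
  fix x y assume x: "x \<in> \<Union>(Green A2)" and y: "y \<in> \<Union>(Green A2)" and le: "green_le A2 x y"
  note x1 = *[OF x] and y1 = *[OF y]
  note ix = green_of[OF A2 x] green_of[OF A1 x1(1)] and iy = green_of[OF A2 y] green_of[OF A1 y1(1)]
  have "\<not> green_less A1 (green_of A1 y) (green_of A1 x)"
  proof
    assume "green_less A1 (green_of A1 y) (green_of A1 x)"
    then have l: "green_less A2 (green_of A2 y) (green_of A2 x)"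
      using r[unfolded approximation_refines_def, THEN conjunct2, THEN conjunct2, THEN conjunct2, THEN conjunct1]
        ix(1,3) iy(1,3) x1(2) y1(2) by blast
    then have "green_of A2 y \<noteq> green_of A2 x" unfolding green_less_def by blast
    then have "green_less A2 (green_of A2 x) (green_of A2 y)" using le unfolding green_le_def by auto
    then show False using green_less_asym[OF A2 l] ix iy by blast
  qed
  then show "green_le A1 x y"
    using green_less_linear[OF A1, of "green_of A1 x" "green_of A1 y"] ix iy unfolding green_le_def by blast
qed

lemma green_refines_chain:
  assumes "\<And>k. 1 \<le> k \<Longrightarrow> green_refines (A (Suc k)) (A k)" "1 \<le> k" "k \<le> j"
  shows "green_refines (A j) (A k)"
  using assms(3)
proof (induction j rule: dec_induct)
  case base
  then show ?case by (rule green_refines_refl)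
next
  case (step n)
  then show ?case using green_refines_trans assms(1)[of n] assms(2) by (metis le_trans)
qed

subsection \<open>Euler polygons\<close>

lemma bouligand_cone_mono: "A \<subseteq> B \<Longrightarrow> bouligand_cone A x \<subseteq> bouligand_cone B x"
  unfolding bouligand_cone_def by blast

lemma quasi_Lyapunov_nonneg: "quasi_Lyapunov D A w \<Longrightarrow> x \<in> D \<Longrightarrow> 0 \<le> w x"
  unfolding quasi_Lyapunov_def by simp

lemma quasi_Lyapunov_pos_iff: "quasi_Lyapunov D A w \<Longrightarrow> x \<in> D \<Longrightarrow> 0 < w x \<longleftrightarrow> x \<in> \<Union>(Green A)"
  unfolding quasi_Lyapunov_def by (metis less_le)

lemma quasi_Lyapunov_continuous: "quasi_Lyapunov D A w \<Longrightarrow> continuous_on D w"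
  unfolding quasi_Lyapunov_def by simp

lemma quasi_Lyapunov_gradient:
  fixes D :: "'a::euclidean_space set" and A :: "('i::wellorder, 'a) approximation"
  assumes "quasi_Lyapunov D A w" "U \<in> Green A" "x \<in> U"
  obtains h g y where "\<forall>z\<in>U. h z = w z" "GDERIV h x :> g"
    "y \<in> green_map A U x" "y \<in> bouligand_cone U x" "1 \<le> g \<bullet> y"
proof -
  obtain W :: "'a set" and h where h: "\<forall>z\<in>U. h z = w z"
    and "\<forall>x\<in>U. \<exists>grad. (GDERIV h x :> grad) \<and>
           (\<exists>y \<in> green_map A U x \<inter> bouligand_cone U x.
              (\<forall>z \<in> green_map A U x \<inter> bouligand_cone U x. grad \<bullet> z \<le> grad \<bullet> y) \<and>
              1 \<le> grad \<bullet> y)"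
    using assms(1)[unfolded quasi_Lyapunov_def, THEN conjunct2, THEN conjunct2, rule_format, OF assms(2)]
    by (elim exE conjE)
  then show ?thesis using that assms(3) by (metis IntD1 IntD2)
qed

text \<open>A Bouligand tangent vector comes with points \<open>X n\<close> that need not lie on the
  ray through \<open>v\<close>. The error of the linear approximation is small compared with
  \<open>norm (X n - y)\<close>, which is of order \<open>t n\<close> because the scaled increments
  converge.\<close>

lemma has_derivative_along_sequence:
  fixes f :: "'a::real_normed_vector \<Rightarrow> real"
  assumes f: "(f has_derivative f') (at y)" and X: "X \<longlonglongrightarrow> y" and t: "\<And>n. 0 < t n"
    and v: "(\<lambda>n. (X n - y) /\<^sub>R t n) \<longlonglongrightarrow> v"
  shows "(\<lambda>n. (f (X n) - f y) / t n) \<longlonglongrightarrow> f' v"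
proof -
  interpret f': bounded_linear f' using f by (rule has_derivative_bounded_linear)
  have "(\<lambda>n. f' ((X n - y) /\<^sub>R t n)) \<longlonglongrightarrow> f' v"
    using v by (rule f'.tendsto)
  moreover have "(\<lambda>n. (f (X n) - f y) / t n - f' ((X n - y) /\<^sub>R t n)) \<longlonglongrightarrow> 0"
  proof (rule LIMSEQ_I)
    fix r :: real assume "0 < r"
    \<comment> \<open>\<open>N\<close> eventually bounds the scaled increments, and
      \<open>e * N = r / 2\<close>.\<close>
    obtain N where N: "N = norm v + 1" "0 < N" by (simp add: add_nonneg_pos)
    define e where "e = r / (2 * N)"
    have "0 < e" using \<open>0 < r\<close> N by (simp add: e_def)
    obtain d where d: "d > 0" "\<And>x. norm (x - y) < d \<Longrightarrow> \<bar>f x - f y - f' (x - y)\<bar> \<le> e * norm (x - y)"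
      using f \<open>0 < e\<close> unfolding has_derivative_at_alt by (metis real_norm_def)
    have "\<forall>\<^sub>F n in sequentially. dist (X n) y < d" using X d(1) tendstoD by blast
    moreover have "\<forall>\<^sub>F n in sequentially. dist ((X n - y) /\<^sub>R t n) v < 1"
      using v tendstoD zero_less_one by blast
    ultimately have "\<forall>\<^sub>F n in sequentially. norm ((f (X n) - f y) / t n - f' ((X n - y) /\<^sub>R t n) - 0) < r"
    proof eventually_elim
      case (elim n)
      have "norm ((X n - y) /\<^sub>R t n) \<le> norm v + 1"
        using elim(2) norm_triangle_sub[of "(X n - y) /\<^sub>R t n" v] by (simp add: dist_norm)
      then have n: "norm (X n - y) / t n \<le> norm v + 1"
        using t[of n] by (simp add: divide_inverse mult.commute)
      have "(f (X n) - f y) / t n - f' ((X n - y) /\<^sub>R t n) = (f (X n) - f y - f' (X n - y)) / t n"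
        unfolding f'.scaleR by (simp add: diff_divide_distrib divide_inverse right_diff_distrib mult.commute)
      also have "\<bar>\<dots>\<bar> \<le> e * norm (X n - y) / t n"
        using d(2)[of "X n"] elim(1) t[of n] by (simp add: dist_norm divide_right_mono)
      also have "\<dots> \<le> e * N"
        using \<open>0 < e\<close> mult_left_mono[OF n, of e] N by simp
      also have "\<dots> = r / 2" using N(2) by (simp add: e_def)
      also have "\<dots> < r" using \<open>0 < r\<close> by simp
      finally show ?case by simp
    qed
    then show "\<exists>no. \<forall>n\<ge>no. norm ((f (X n) - f y) / t n - f' ((X n - y) /\<^sub>R t n) - 0) < r"
      by (simp add: eventually_sequentially)
  qed
  ultimately have "(\<lambda>n. ((f (X n) - f y) / t n - f' ((X n - y) /\<^sub>R t n)) + f' ((X n - y) /\<^sub>R t n)) \<longlonglongrightarrow> 0 + f' v"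
    by (intro tendsto_add)
  then show ?thesis by simp
qed

text \<open>The points realizing a tangent vector of \<open>U\<close> belong to \<open>U\<close>,
  where \<open>w\<close> agrees with its smooth extension. The gradient of the extension therefore
  measures the actual growth of \<open>w\<close> from \<open>y\<close> to \<open>q\<close>, up to an
  error \<open>e * h\<close>.\<close>

lemma quasi_Lyapunov_step:
  fixes D :: "'a::euclidean_space set" and A :: "('i::wellorder, 'a) approximation"
  assumes A: "invariant_partial_approximation D F \<epsilon> A" and w: "quasi_Lyapunov D A w"
    and c: "\<forall>x\<in>closure D. \<forall>v\<in>F x. norm v \<le> c"
    and y: "y \<in> \<Union>(Green A)" and e: "0 < e"
  obtains v q h \<rho> where "v \<in> green_map A (green_of A y) y" "norm v \<le> c + \<epsilon>" "q \<in> green_of A y"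
    "0 < h" "h < e" "norm (q - y - h *\<^sub>R v) \<le> e * h" "w y + (1 - e) * h \<le> w q"
    "0 < \<rho>" "\<rho> \<le> e * h"
    "\<forall>p\<in>\<Union>(Green A). dist p y < \<rho> \<longrightarrow> green_le A p y \<and> w p \<le> w y + e * h"
proof -
  let ?U = "green_of A y"
  note U = green_of[OF A y]
  obtain f g v where f: "\<forall>z\<in>?U. f z = w z" and g: "GDERIV f y :> g"
    and v: "v \<in> green_map A ?U y" "v \<in> bouligand_cone ?U y" "1 \<le> g \<bullet> v"
    using quasi_Lyapunov_gradient[OF w U] by metis
  have ycl: "y \<in> closure ?U" using U closure_subset by blast
  have UD: "?U \<subseteq> D" using green_subset[OF A U(1)] .
  have "norm v \<le> c + \<epsilon>"
  proof -
    have "v \<in> bouligand_cone (closure ?U) y"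
      using v(2) bouligand_cone_mono[OF closure_subset] by blast
    then obtain u where "u \<in> F y" "dist v u \<le> \<epsilon>"
      using green_map_cone_approx[OF A U(1) ycl v(1)] by blast
    moreover have "y \<in> closure D" using U(2) UD closure_subset by blast
    ultimately show ?thesis
      using c[rule_format, of y u] norm_triangle_sub[of v u] by (simp add: dist_norm)
  qed
  obtain X t where X: "\<And>n. X n \<in> ?U" "X \<longlonglongrightarrow> y" "\<And>n. 0 < t n" "t \<longlonglongrightarrow> (0::real)"
      "(\<lambda>n. (X n - y) /\<^sub>R t n) \<longlonglongrightarrow> v"
    using v(2) unfolding bouligand_cone_def by blast
  have "(\<lambda>n. (f (X n) - f y) / t n) \<longlonglongrightarrow> v \<bullet> g"
    using has_derivative_along_sequence[OF _ X(2,3,5)] g unfolding gderiv_def by blast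
  moreover have "1 - e < v \<bullet> g" using v(3) e by (simp add: inner_commute)
  ultimately have "\<forall>\<^sub>F n in sequentially. 1 - e < (f (X n) - f y) / t n"
    by (rule order_tendstoD(1))
  moreover have "\<forall>\<^sub>F n in sequentially. t n < e" using X(4) e by (rule order_tendstoD(2))
  moreover have "\<forall>\<^sub>F n in sequentially. dist ((X n - y) /\<^sub>R t n) v < e" using X(5) e by (rule tendstoD)
  ultimately have "\<forall>\<^sub>F n in sequentially. 1 - e < (f (X n) - f y) / t n \<and> t n < e \<and> dist ((X n - y) /\<^sub>R t n) v < e"
    by eventually_elim simp
  then obtain n where n: "1 - e < (f (X n) - f y) / t n" "t n < e" "dist ((X n - y) /\<^sub>R t n) v < e"
    using eventually_happens'[OF sequentially_bot] by blast
  define q h where "q = X n" and "h = t n"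
  have h: "0 < h" "h < e" using X n by (auto simp: h_def)
  have q: "q \<in> ?U" using X by (simp add: q_def)
  have "norm (q - y - h *\<^sub>R v) = h * norm ((q - y) /\<^sub>R h - v)"
  proof -
    have "q - y - h *\<^sub>R v = h *\<^sub>R ((q - y) /\<^sub>R h - v)" using h by (simp add: scaleR_diff_right)
    then show ?thesis using h by (metis abs_of_pos norm_scaleR)
  qed
  also have "\<dots> \<le> e * h" using n(3) h by (simp add: q_def h_def dist_norm mult.commute)
  finally have qy: "norm (q - y - h *\<^sub>R v) \<le> e * h" .
  have wq: "w y + (1 - e) * h \<le> w q"
    using n(1) h f U(2) q by (simp add: q_def h_def field_simps)
  obtain \<rho>\<^sub>1 where \<rho>\<^sub>1: "\<rho>\<^sub>1 > 0" "\<And>V p. V \<in> Green A \<Longrightarrow> p \<in> V \<Longrightarrow> dist p y < \<rho>\<^sub>1 \<Longrightarrow> V = ?U \<or> green_less A V ?U"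
    using green_initial_neighbourhood[OF A U] by blast
  \<comment> \<open>The radius is fixed after \<open>h\<close>, so that replacing \<open>y\<close>
    by a point \<open>p\<close> within it costs at most \<open>e * h\<close> both in position and in
    the value of \<open>w\<close>, a small fraction of what the step gains. The first bound on the
    radius controls the order.\<close>
  have "0 < e * h" using e h by simp
  then obtain \<rho>\<^sub>2 where \<rho>\<^sub>2: "\<rho>\<^sub>2 > 0" "\<And>p. p \<in> D \<Longrightarrow> dist p y < \<rho>\<^sub>2 \<Longrightarrow> dist (w p) (w y) < e * h"
    using quasi_Lyapunov_continuous[OF w] U UD unfolding continuous_on_iff by (metis subsetD)
  show ?thesis
  proof (rule that[of v q h "min (min \<rho>\<^sub>1 \<rho>\<^sub>2) (e * h)"])
    show "\<forall>p\<in>\<Union>(Green A). dist p y < min (min \<rho>\<^sub>1 \<rho>\<^sub>2) (e * h) \<longrightarrow> green_le A p y \<and> w p \<le> w y + e * h"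
    proof (intro ballI impI)
      fix p assume p: "p \<in> \<Union>(Green A)" "dist p y < min (min \<rho>\<^sub>1 \<rho>\<^sub>2) (e * h)"
      then have "p \<in> D" using green_subset[OF A] by blast
      then have "w p \<le> w y + e * h" using \<rho>\<^sub>2(2)[of p] p by (simp add: dist_real_def)
      moreover have "green_le A p y"
        using \<rho>\<^sub>1(2)[OF green_of[OF A p(1)]] p(2) unfolding green_le_def by simp
      ultimately show "green_le A p y \<and> w p \<le> w y + e * h" by blast
    qed
  qed (use \<open>norm v \<le> c + \<epsilon>\<close> v q h qy wq \<rho>\<^sub>1 \<rho>\<^sub>2 \<open>0 < e * h\<close> in auto)
qed

text \<open>The coefficient of \<open>u i\<close> is the time spent in the i-th step up to time
  \<open>s\<close>. The formula is the integral of a piecewise constant velocity, written without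
  locating the step that contains \<open>s\<close>.\<close>

definition polygon :: "'a::real_vector \<Rightarrow> nat \<Rightarrow> (nat \<Rightarrow> real) \<Rightarrow> (nat \<Rightarrow> 'a) \<Rightarrow> real \<Rightarrow> 'a" where
  "polygon a N t u s = a + (\<Sum>i<N. (min s (t (Suc i)) - min s (t i)) *\<^sub>R u i)"

lemma polygon_node:
  assumes "mono t" "k \<le> N"
  shows "polygon a N t u (t k) = a + (\<Sum>i<k. (t (Suc i) - t i) *\<^sub>R u i)"
proof -
  have "(\<Sum>i<N. (min (t k) (t (Suc i)) - min (t k) (t i)) *\<^sub>R u i)
      = (\<Sum>i<k. (min (t k) (t (Suc i)) - min (t k) (t i)) *\<^sub>R u i)"
  proof (rule sum.mono_neutral_right)
    show "\<forall>i\<in>{..<N} - {..<k}. (min (t k) (t (Suc i)) - min (t k) (t i)) *\<^sub>R u i = 0"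
      using monoD[OF \<open>mono t\<close>] by (simp add: min_absorb1 le_SucI)
  qed (use \<open>k \<le> N\<close> in auto)
  also have "\<dots> = (\<Sum>i<k. (t (Suc i) - t i) *\<^sub>R u i)"
    using monoD[OF \<open>mono t\<close>] by (intro sum.cong) (auto simp: min_absorb2)
  finally show ?thesis by (simp add: polygon_def)
qed

text \<open>A mean value theorem for polygons: the mean velocity over \<open>[s, s']\<close> is a
  convex combination of the velocities of the steps meeting this interval, weighted by the share of
  time spent in each.\<close>

lemma polygon_slope_convex:
  assumes t: "mono t" and S: "convex S" and s: "t 0 \<le> s" "s < s'" "s' \<le> t N"
    and u: "\<And>i. i < N \<Longrightarrow> t i < s' \<Longrightarrow> s < t (Suc i) \<Longrightarrow> u i \<in> S"
  shows "(polygon a N t u s' - polygon a N t u s) /\<^sub>R (s' - s) \<in> S"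
proof -
  define l where "l i = (min s' (t (Suc i)) - min s' (t i)) - (min s (t (Suc i)) - min s (t i))" for i
  have mono: "t i \<le> t (Suc i)" for i using t by (simp add: monoD)
  have l0: "0 \<le> l i" for i using mono[of i] s(2) by (auto simp: l_def min_def)
  have lpos: "t i < s' \<and> s < t (Suc i)" if "l i \<noteq> 0" for i
    using that mono[of i] s(2) by (auto simp: l_def min_def split: if_splits)
  have suml: "(\<Sum>i<N. l i) = s' - s"
  proof -
    have "(\<Sum>i<N. l i) = (min s' (t N) - min s' (t 0)) - (min s (t N) - min s (t 0))"
      unfolding l_def sum_subtractf[of "\<lambda>i. min s' (t (Suc i)) - min s' (t i)"]
        sum_lessThan_telescope[of "\<lambda>i. min s' (t i)"] sum_lessThan_telescope[of "\<lambda>i. min s (t i)"] by simp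
    then show ?thesis using s by auto
  qed
  \<comment> \<open>Only steps of positive weight are kept, since \<open>u i \<in> S\<close> is
    known only for steps that meet the interval.\<close>
  define J where "J = {i\<in>{..<N}. l i \<noteq> 0}"
  have J: "finite J" "J \<subseteq> {..<N}" by (auto simp: J_def)
  have "polygon a N t u s' - polygon a N t u s = (\<Sum>i<N. l i *\<^sub>R u i)"
    by (simp add: polygon_def l_def sum_subtractf[symmetric] scaleR_diff_left)
  also have "\<dots> = (\<Sum>i\<in>J. l i *\<^sub>R u i)"
    by (rule sum.mono_neutral_right) (auto simp: J_def)
  finally have "(polygon a N t u s' - polygon a N t u s) /\<^sub>R (s' - s) = (\<Sum>i\<in>J. (l i / (s' - s)) *\<^sub>R u i)"
    by (simp add: scaleR_sum_right divide_inverse mult.commute)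
  also have "\<dots> \<in> S"
  proof (rule convex_sum[OF J(1) S])
    have "(\<Sum>i\<in>J. l i) = (\<Sum>i<N. l i)"
      by (rule sum.mono_neutral_left) (auto simp: J_def)
    then show "(\<Sum>i\<in>J. l i / (s' - s)) = 1"
      using suml s(2) by (simp add: sum_divide_distrib[symmetric])
    show "0 \<le> l i / (s' - s)" for i using l0 s(2) by simp
    show "u i \<in> S" if "i \<in> J" for i using that u lpos[of i] by (auto simp: J_def)
  qed
  finally show ?thesis .
qed

text \<open>A step chosen at \<open>y\<close> serves every green point within
  \<open>\<rho> y\<close>. Finitely many such balls cover \<open>K\<close>, and the least of their
  finitely many step lengths is a positive \<open>h\<^sub>0\<close>; without compactness the lengths
  could tend to 0 and the polygon could stop early.\<close>

lemma quasi_Lyapunov_uniform_step: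
  fixes D :: "'a::euclidean_space set" and A :: "('i::wellorder, 'a) approximation"
  assumes A: "invariant_partial_approximation D F \<epsilon> A" and w: "quasi_Lyapunov D A w"
    and c: "\<forall>x\<in>closure D. \<forall>v\<in>F x. norm v \<le> c" and \<epsilon>: "\<epsilon> \<le> 1"
    and K: "compact K" "K \<noteq> {}" "K \<subseteq> \<Union>(Green A)" and e: "0 < e" "e \<le> 1 / 4"
  obtains h\<^sub>0 where "0 < h\<^sub>0"
    "\<And>p. p \<in> K \<Longrightarrow> \<exists>y v q h. v \<in> green_map A (green_of A y) y \<and> y \<in> \<Union>(Green A) \<and> q \<in> green_of A y \<and>
        h\<^sub>0 \<le> h \<and> h \<le> e \<and> green_le A p y \<and> dist y p \<le> e \<and> norm ((q - p) /\<^sub>R h - v) \<le> 2 * e \<and>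
        norm (q - p) \<le> (c + 2) * h \<and> w p + h / 2 \<le> w q"
proof -
  define Q where "Q y v q h \<rho> \<longleftrightarrow> v \<in> green_map A (green_of A y) y \<and> norm v \<le> c + \<epsilon> \<and> q \<in> green_of A y \<and>
    0 < h \<and> h < e \<and> norm (q - y - h *\<^sub>R v) \<le> e * h \<and> w y + (1 - e) * h \<le> w q \<and> 0 < \<rho> \<and> \<rho> \<le> e * h \<and>
    (\<forall>p\<in>\<Union>(Green A). dist p y < \<rho> \<longrightarrow> green_le A p y \<and> w p \<le> w y + e * h)" for y v q h \<rho>
  have "\<exists>v q h \<rho>. Q y v q h \<rho>" if "y \<in> K" for y
  proof -
    have y: "y \<in> \<Union>(Green A)" using that K by blast
    show ?thesis
      by (rule quasi_Lyapunov_step[OF A w c y e(1)]) (unfold Q_def, blast)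
  qed
  then obtain v q h \<rho> where "\<And>y. y \<in> K \<Longrightarrow> Q y (v y) (q y) (h y) (\<rho> y)" by metis
  note st = this[unfolded Q_def]
  have pos: "0 < h y" "0 < \<rho> y" if "y \<in> K" for y using st[OF that] by blast+
  have "K \<subseteq> (\<Union>y\<in>K. ball y (\<rho> y))"
    using pos by (intro subsetI UN_I) auto
  then obtain C where C: "C \<subseteq> K" "finite C" "K \<subseteq> (\<Union>y\<in>C. ball y (\<rho> y))"
    using compactE_image[OF K(1), of K "\<lambda>y. ball y (\<rho> y)"] by auto
  have "C \<noteq> {}" using C K by auto
  define h\<^sub>0 where "h\<^sub>0 = Min (h ` C)"
  show ?thesis
  proof (rule that[of h\<^sub>0])
    show "0 < h\<^sub>0" unfolding h\<^sub>0_def using C \<open>C \<noteq> {}\<close> pos by auto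
    fix p assume p: "p \<in> K"
    then obtain y where y: "y \<in> C" "dist p y < \<rho> y" using C by (auto simp: dist_commute)
    have yK: "y \<in> K" using y C by blast
    have hm: "h\<^sub>0 \<le> h y" unfolding h\<^sub>0_def using y C by simp
    note s = st[OF yK]
    have near: "\<forall>p\<in>\<Union>(Green A). dist p y < \<rho> y \<longrightarrow> green_le A p y \<and> w p \<le> w y + e * h y"
      using s by (elim conjE)
    have "p \<in> \<Union>(Green A)" using p K by blast
    then have le: "green_le A p y" and wp: "w p \<le> w y + e * h y" using near y(2) by blast+
    have h: "0 < h y" "h y < e" and vq: "v y \<in> green_map A (green_of A y) y" "q y \<in> green_of A y"
      and nv: "norm (v y) \<le> c + \<epsilon>" and qy: "norm (q y - y - h y *\<^sub>R v y) \<le> e * h y"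
      and wq: "w y + (1 - e) * h y \<le> w (q y)" and \<rho>: "\<rho> y \<le> e * h y"
      using s by blast+
    have yG: "y \<in> \<Union>(Green A)" using yK K by blast
    have yp: "norm (y - p) \<le> e * h y" using \<rho> y(2) by (simp add: dist_norm norm_minus_commute)
    have eh: "e * h y \<le> e" using h e by (simp add: mult_left_le)
    have d: "norm (q y - p - h y *\<^sub>R v y) \<le> 2 * e * h y"
      using norm_triangle_ineq[of "q y - y - h y *\<^sub>R v y" "y - p"] qy yp by (simp add: algebra_simps)
    have "norm ((q y - p) /\<^sub>R h y - v y) = norm (q y - p - h y *\<^sub>R v y) / h y"
    proof -
      have "(q y - p) /\<^sub>R h y - v y = (q y - p - h y *\<^sub>R v y) /\<^sub>R h y"
        using h by (simp add: scaleR_diff_right)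
      then show ?thesis using h by (simp add: divide_inverse mult.commute)
    qed
    also have "\<dots> \<le> 2 * e" using d h by (simp add: field_simps)
    finally have slope: "norm ((q y - p) /\<^sub>R h y - v y) \<le> 2 * e" .
    \<comment> \<open>The speed bound is \<open>norm v \<le> c + \<epsilon> \<le> c + 1\<close> plus
      the slope error \<open>2 * e \<le> 1\<close>.\<close>
    have "norm (q y - p) \<le> 2 * e * h y + h y * norm (v y)"
      using norm_triangle_ineq[of "q y - p - h y *\<^sub>R v y" "h y *\<^sub>R v y"] d h by simp
    also have "\<dots> \<le> 1 * h y + h y * (c + 1)"
      using nv \<epsilon> e h by (intro add_mono mult_right_mono mult_left_mono) auto
    finally have len: "norm (q y - p) \<le> (c + 2) * h y" by (simp add: algebra_simps)
    \<comment> \<open>Of the growth \<open>(1 - e) * h\<close> from \<open>y\<close> at most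
      \<open>e * h\<close> is lost by starting at \<open>p\<close>. With
      \<open>e \<le> 1 / 4\<close> at least \<open>h / 2\<close> remains.\<close>
    have "e * h y \<le> (1 / 4) * h y" using e h by (intro mult_right_mono) auto
    then have wh: "w p + h y / 2 \<le> w (q y)" using wq wp left_diff_distrib[of 1 e "h y"] by linarith
    show "\<exists>y v q h. v \<in> green_map A (green_of A y) y \<and> y \<in> \<Union>(Green A) \<and> q \<in> green_of A y \<and>
        h\<^sub>0 \<le> h \<and> h \<le> e \<and> green_le A p y \<and> dist y p \<le> e \<and> norm ((q - p) /\<^sub>R h - v) \<le> 2 * e \<and>
        norm (q - p) \<le> (c + 2) * h \<and> w p + h / 2 \<le> w q"
    proof (rule exI[of _ y], rule exI[of _ "v y"], rule exI[of _ "q y"], rule exI[of _ "h y"], intro conjI)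
      show "dist y p \<le> e" using yp eh by (simp add: dist_norm)
    qed (use vq yG hm h le slope len wh in auto)
  qed
qed

text \<open>
  For a time \<open>s\<close> in the \<open>i\<close>-th step of the polygon \<open>x\<close>, \<open>Y s\<close> is the point where the velocity \<open>V s\<close> of that
  step is taken, and \<open>P s\<close> is the \<^emph>\<open>end\<close> node of the step, which lies in the same green set as \<open>Y s\<close>.
\<close>

lemma Euler_polygon:
  fixes D :: "'a::euclidean_space set" and A :: "('i::wellorder, 'a) approximation"
  assumes A: "invariant_partial_approximation D F \<epsilon> A" and w: "quasi_Lyapunov D A w"
    and c: "\<forall>x\<in>closure D. \<forall>v\<in>F x. norm v \<le> c" "0 < c" and \<epsilon>: "\<epsilon> \<le> 1"
    and r: "compact (D \<inter> cball x0 r)" and p0: "p0 \<in> \<Union>(Green A)" "dist p0 x0 \<le> r / 2"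
    and T: "0 \<le> T" "(c + 2) * T \<le> r / 2" and e: "0 < e" "e \<le> 1 / 4"
  obtains x P Y V where
    "\<And>s s'. 0 \<le> s \<Longrightarrow> s \<le> s' \<Longrightarrow> s' \<le> T \<Longrightarrow> norm (x s' - x s) \<le> (c + 2) * (s' - s)" "x 0 = p0"
    "\<And>s. 0 \<le> s \<Longrightarrow> s \<le> T \<Longrightarrow> P s \<in> \<Union>(Green A) \<and> Y s \<in> green_of A (P s) \<and>
       V s \<in> green_map A (green_of A (P s)) (Y s) \<and> dist (P s) (x s) \<le> (c + 2) * e \<and>
       dist (Y s) (x s) \<le> (c + 3) * e \<and> s / 2 \<le> w (P s)"
    "\<And>s s'. 0 \<le> s \<Longrightarrow> s \<le> s' \<Longrightarrow> s' \<le> T \<Longrightarrow> green_le A (P s) (P s')"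
    "\<And>s s' S. 0 \<le> s \<Longrightarrow> s < s' \<Longrightarrow> s' \<le> T \<Longrightarrow> convex S \<Longrightarrow>
       (\<And>\<tau>. s \<le> \<tau> \<Longrightarrow> \<tau> \<le> s' \<Longrightarrow> cball (V \<tau>) (2 * e) \<subseteq> S) \<Longrightarrow> (x s' - x s) /\<^sub>R (s' - s) \<in> S"
proof -
  have GD: "\<Union>(Green A) \<subseteq> D" using green_subset[OF A] by blast
  have p0D: "p0 \<in> D" using p0 GD by blast
  have "0 \<le> r / 2" using p0(2) zero_le_dist order_trans by blast
  \<comment> \<open>\<open>w p0\<close> is positive and \<open>w\<close> vanishes on
    \<open>D\<close> off the green union, so this superlevel set is green; being closed in a compact
    set, it is compact. Nodes stay in it up to time \<open>T\<close>, because \<open>w\<close> grows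
    and the distance travelled is at most \<open>r / 2\<close>.\<close>
  define K where "K = (D \<inter> cball x0 r) \<inter> w -` {w p0..}"
  have "continuous_on (D \<inter> cball x0 r) w"
    using quasi_Lyapunov_continuous[OF w] by (rule continuous_on_subset) simp
  then have "closed K" unfolding K_def
    using compact_imp_closed[OF r] by (rule continuous_closed_preimage) simp
  then have "compact K" using r unfolding K_def by (metis Int_lower1 compact_Int_closed inf.absorb_iff2)
  moreover have "p0 \<in> K" using p0 p0D \<open>0 \<le> r / 2\<close> by (simp add: K_def dist_commute)
  moreover have KG: "K \<subseteq> \<Union>(Green A)"
  proof
    fix p assume "p \<in> K"
    then have "p \<in> D" "w p0 \<le> w p" by (auto simp: K_def)
    then show "p \<in> \<Union>(Green A)"
      using quasi_Lyapunov_pos_iff[OF w, of p] quasi_Lyapunov_pos_iff[OF w p0D] p0 by linarith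
  qed
  ultimately obtain h\<^sub>0 where "0 < h\<^sub>0" and st: "\<And>p. p \<in> K \<Longrightarrow> \<exists>y v q h. v \<in> green_map A (green_of A y) y \<and>
        y \<in> \<Union>(Green A) \<and> q \<in> green_of A y \<and>
        h\<^sub>0 \<le> h \<and> h \<le> e \<and> green_le A p y \<and> dist y p \<le> e \<and> norm ((q - p) /\<^sub>R h - v) \<le> 2 * e \<and>
        norm (q - p) \<le> (c + 2) * h \<and> w p + h / 2 \<le> w q"
    using quasi_Lyapunov_uniform_step[OF A w c(1) \<epsilon> _ _ _ e, of K] by (metis empty_iff)
  define R where "R p y v q h \<longleftrightarrow> v \<in> green_map A (green_of A y) y \<and> y \<in> \<Union>(Green A) \<and> q \<in> green_of A y \<and>
        h\<^sub>0 \<le> h \<and> h \<le> e \<and> green_le A p y \<and> dist y p \<le> e \<and> norm ((q - p) /\<^sub>R h - v) \<le> 2 * e \<and>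
        norm (q - p) \<le> (c + 2) * h \<and> w p + h / 2 \<le> w q" for p y v q h
  have "\<forall>p. \<exists>y v q h. p \<in> K \<longrightarrow> R p y v q h" using st unfolding R_def by blast
  then obtain fy fv fq fh where f: "\<And>p. p \<in> K \<Longrightarrow> R p (fy p) (fv p) (fq p) (fh p)" by metis
  \<comment> \<open>Outside \<open>K\<close> the iteration stands still and its time steps take the
    default \<open>h\<^sub>0\<close>. Thus the times exceed every bound unconditionally, and
    membership in \<open>K\<close> has to be shown only for nodes with
    \<open>t i \<le> T\<close>.\<close>
  define p where "p i = ((\<lambda>p. if p \<in> K then fq p else p) ^^ i) p0" for i
  define \<eta> where "\<eta> i = (if p i \<in> K then fh (p i) else h\<^sub>0)" for i
  define t where "t i = (\<Sum>k<i. \<eta> k)" for i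
  have pSuc: "p (Suc i) = fq (p i)" if "p i \<in> K" for i using that by (simp add: p_def)
  have \<eta>: "h\<^sub>0 \<le> \<eta> i" for i using f[of "p i"] by (simp add: \<eta>_def R_def)
  have \<eta>0: "0 < \<eta> i" for i using \<eta>[of i] \<open>0 < h\<^sub>0\<close> by linarith
  have t0: "t 0 = 0" and tSuc: "t (Suc i) = t i + \<eta> i" for i by (simp_all add: t_def)
  have tmono: "mono t" by (rule incseq_SucI) (simp add: tSuc \<eta>0 less_imp_le)
  have tpos: "0 \<le> t i" for i using monoD[OF tmono, of 0 i] t0 by simp
  have tlarge: "\<exists>i. s < t i" for s
  proof -
    have "of_nat i * h\<^sub>0 \<le> t i" for i
      by (induction i) (use \<eta> in \<open>auto simp: t0 tSuc algebra_simps intro: add_mono\<close>)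
    moreover obtain i :: nat where "s < of_nat i * h\<^sub>0" using reals_Archimedean3[OF \<open>0 < h\<^sub>0\<close>] by blast
    ultimately show ?thesis using less_le_trans by blast
  qed
  \<comment> \<open>The condition bounds the preceding time, so that the first node after
    \<open>T\<close> is included: it is the end node of the last step. It may leave
    \<open>K\<close>, but it is still green and satisfies the growth estimate.\<close>
  have inv: "p i \<in> \<Union>(Green A) \<and> norm (p i - p0) \<le> (c + 2) * t i \<and> w p0 + t i / 2 \<le> w (p i) \<and> (t i \<le> T \<longrightarrow> p i \<in> K)"
    if "i = 0 \<or> t (i - 1) \<le> T" for i
    using that
  proof (induction i)
    case 0
    then show ?case using p0 \<open>p0 \<in> K\<close> by (simp add: p_def t0)
  next
    case (Suc i)
    then have "t i \<le> T" by simp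
    moreover have "i = 0 \<or> t (i - 1) \<le> T"
      using \<open>t i \<le> T\<close> monoD[OF tmono, of "i - 1" i] by auto
    ultimately have pi: "norm (p i - p0) \<le> (c + 2) * t i" "w p0 + t i / 2 \<le> w (p i)" and iK: "p i \<in> K"
      using Suc.IH by blast+
    have q: "fq (p i) \<in> green_of A (fy (p i))" "fy (p i) \<in> \<Union>(Green A)"
        "norm (fq (p i) - p i) \<le> (c + 2) * fh (p i)" "w (p i) + fh (p i) / 2 \<le> w (fq (p i))"
      using f[OF iK] unfolding R_def by blast+
    have \<eta>i: "\<eta> i = fh (p i)" using iK by (simp add: \<eta>_def)
    have 1: "p (Suc i) \<in> \<Union>(Green A)"
      using q(1) green_of(1)[OF A q(2)] unfolding pSuc[OF iK] by blast
    have 2: "norm (p (Suc i) - p0) \<le> (c + 2) * t (Suc i)"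
      using norm_triangle_ineq[of "fq (p i) - p i" "p i - p0"] q(3) pi(1)
      unfolding pSuc[OF iK] tSuc \<eta>i by (simp add: algebra_simps)
    have 3: "w p0 + t (Suc i) / 2 \<le> w (p (Suc i))"
      using q(4) pi(2) unfolding pSuc[OF iK] tSuc \<eta>i by (simp add: add_divide_distrib)
    have "p (Suc i) \<in> K" if "t (Suc i) \<le> T"
    proof -
      have "(c + 2) * t (Suc i) \<le> (c + 2) * T" using that c(2) by simp
      then have "dist (p (Suc i)) p0 \<le> r / 2" using 2 T(2) by (simp add: dist_norm)
      then have "dist (p (Suc i)) x0 \<le> r" using p0(2) dist_triangle[of "p (Suc i)" x0 p0] by simp
      moreover have "w p0 \<le> w (p (Suc i))" using 3 tpos[of "Suc i"] by linarith
      ultimately show ?thesis using 1 GD by (auto simp: K_def dist_commute)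
    qed
    with 1 2 3 show ?case by blast
  qed
  have inK: "p i \<in> K" if "t i \<le> T" for i
    using inv[of i] that monoD[OF tmono, of "i - 1" i] by force
  have \<eta>e: "\<eta> i \<le> e" if "t i \<le> T" for i
    using f[OF inK[OF that]] inK[OF that] by (simp add: \<eta>_def R_def)
  define ix where "ix s = (LEAST i. s < t (Suc i))" for s
  have ix2: "s < t (Suc (ix s))" if "0 \<le> s" for s
  proof -
    obtain i where "s < t i" using tlarge by blast
    with that have "s < t (Suc (i - 1))" by (cases i) (auto simp: t0)
    then show ?thesis unfolding ix_def by (rule LeastI)
  qed
  have ix1: "t (ix s) \<le> s" if "0 \<le> s" for s
  proof (cases "ix s")
    case (Suc k)
    then have "\<not> s < t (Suc k)" using not_less_Least[of k "\<lambda>i. s < t (Suc i)"] unfolding ix_def by simp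
    then show ?thesis using Suc by simp
  qed (use that t0 in simp)
  have ix_eq: "ix s = i" if "t i \<le> s" "s < t (Suc i)" for s i
  proof -
    have "0 \<le> s" using that tpos[of i] by linarith
    note a = ix1[OF this] ix2[OF this]
    have "\<not> Suc i \<le> ix s" using monoD[OF tmono, of "Suc i" "ix s"] a that by linarith
    moreover have "\<not> Suc (ix s) \<le> i" using monoD[OF tmono, of "Suc (ix s)" i] a that by linarith
    ultimately show ?thesis by linarith
  qed
  have ix_mono: "ix s \<le> ix s'" if "0 \<le> s" "s \<le> s'" for s s'
  proof (rule ccontr)
    assume "\<not> ix s \<le> ix s'"
    then have "t (Suc (ix s')) \<le> t (ix s)" using monoD[OF tmono] by simp
    then show False using ix1[of s] ix2[of s'] that by linarith
  qed
  \<comment> \<open>The polygon includes the whole step that contains \<open>T\<close>, so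
    \<open>t N\<close> lies beyond \<open>T\<close>.\<close>
  define N where "N = Suc (ix T)"
  have TN: "T \<le> t N" using ix2[OF T(1)] by (simp add: N_def)
  have iT: "t i \<le> T" if "i < N" for i
    using monoD[OF tmono, of i "ix T"] that ix1[OF T(1)] by (simp add: N_def)
  have ixN: "ix s < N" if "0 \<le> s" "s \<le> T" for s using ix_mono[OF that] by (simp add: N_def)
  define u where "u i = (p (Suc i) - p i) /\<^sub>R \<eta> i" for i
  define x where "x = polygon p0 N t u"
  have node: "x (t k) = p k" if "k \<le> N" for k
  proof -
    have "(t (Suc i) - t i) *\<^sub>R u i = p (Suc i) - p i" for i
      using \<eta>0[of i] by (simp add: tSuc u_def)
    then have "x (t k) = p0 + (\<Sum>i<k. p (Suc i) - p i)"
      using polygon_node[OF tmono that, of p0 u] by (simp add: x_def)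
    then have "x (t k) = p0 + (p k - p 0)" by (simp only: sum_lessThan_telescope)
    then show ?thesis by (simp add: p_def)
  qed
  have slope: "(x s' - x s) /\<^sub>R (s' - s) \<in> S"
    if "0 \<le> s" "s < s'" "s' \<le> t N" "convex S" "\<And>i. i < N \<Longrightarrow> t i < s' \<Longrightarrow> s < t (Suc i) \<Longrightarrow> u i \<in> S" for s s' S
    unfolding x_def by (rule polygon_slope_convex[OF tmono]) (use that t0 in auto)
  have un: "norm (u i) \<le> c + 2" if "i < N" for i
  proof -
    have "norm (p (Suc i) - p i) \<le> (c + 2) * \<eta> i"
      using f[OF inK[OF iT[OF that]]] inK[OF iT[OF that]] pSuc by (simp add: R_def \<eta>_def)
    moreover have "norm (u i) = norm (p (Suc i) - p i) / \<eta> i"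
      using \<eta>0[of i] by (simp add: u_def divide_inverse mult.commute)
    ultimately show ?thesis using \<eta>0[of i] by (simp add: pos_divide_le_eq)
  qed
  have lip: "norm (x s' - x s) \<le> (c + 2) * (s' - s)" if "0 \<le> s" "s \<le> s'" "s' \<le> t N" for s s'
  proof (cases "s = s'")
    case False
    then have "s < s'" using that by simp
    then have "(x s' - x s) /\<^sub>R (s' - s) \<in> cball 0 (c + 2)"
      using slope[OF that(1) _ that(3), of "cball 0 (c + 2)"] un by simp
    moreover have "norm ((x s' - x s) /\<^sub>R (s' - s)) = norm (x s' - x s) / (s' - s)"
      using \<open>s < s'\<close> by (simp add: divide_inverse mult.commute)
    ultimately show ?thesis using \<open>s < s'\<close> by (simp add: pos_divide_le_eq)
  qed simp
  have step_le: "green_le A (p i) (p (Suc i))" if "t i \<le> T" for i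
  proof -
    have q: "fq (p i) \<in> green_of A (fy (p i))" "fy (p i) \<in> \<Union>(Green A)" "green_le A (p i) (fy (p i))"
      using f[OF inK[OF that]] unfolding R_def by blast+
    then have "green_of A (fq (p i)) = green_of A (fy (p i))"
      using green_of_eq[OF A green_of(1)[OF A q(2)]] by blast
    then show ?thesis using q(3) pSuc[OF inK[OF that]] by (simp add: green_le_def)
  qed
  have pG: "p i \<in> \<Union>(Green A)" if "i \<le> N" for i
    using inv[of i] iT[of "i - 1"] that by (cases i) auto
  have ple: "green_le A (p i) (p j)" if "i \<le> j" "j \<le> N" for i j
    using that
  proof (induction j rule: dec_induct)
    case base
    then show ?case by (simp add: green_le_def)
  next
    case (step n)
    then have "green_le A (p i) (p n)" "green_le A (p n) (p (Suc n))" using step_le iT by auto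
    then show ?case using green_le_trans[OF A pG[of i] pG[of n]] step that by simp
  qed
  show ?thesis
  proof (rule that[of x "\<lambda>s. p (Suc (ix s))" "\<lambda>s. fy (p (ix s))" "\<lambda>s. fv (p (ix s))"])
    show "norm (x s' - x s) \<le> (c + 2) * (s' - s)" if "0 \<le> s" "s \<le> s'" "s' \<le> T" for s s'
      using lip that TN by simp
    show "x 0 = p0" using node[of 0] by (simp add: t0 p_def)
    show "green_le A (p (Suc (ix s))) (p (Suc (ix s')))" if "0 \<le> s" "s \<le> s'" "s' \<le> T" for s s'
    proof (rule ple)
      show "Suc (ix s) \<le> Suc (ix s')" using ix_mono that by simp
      show "Suc (ix s') \<le> N" using ixN[of s'] that by simp
    qed
    fix s :: real
    assume s: "0 \<le> s" "s \<le> T"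
    let ?i = "ix s"
    have i: "?i < N" "t ?i \<le> s" "s < t (Suc ?i)" using ixN[OF s] ix1 ix2 s by auto
    have iK: "p ?i \<in> K" using inK iT i by blast
    have \<eta>i: "\<eta> ?i \<le> e" using \<eta>e iT i by blast
    have q: "fq (p ?i) \<in> green_of A (fy (p ?i))" "fy (p ?i) \<in> \<Union>(Green A)"
        "fv (p ?i) \<in> green_map A (green_of A (fy (p ?i))) (fy (p ?i))" "dist (fy (p ?i)) (p ?i) \<le> e"
      using f[OF iK] unfolding R_def by blast+
    have eq: "green_of A (p (Suc ?i)) = green_of A (fy (p ?i))"
      using q(1) green_of_eq[OF A green_of(1)[OF A q(2)]] pSuc[OF iK] by simp
    have tN: "t (Suc ?i) \<le> t N" using monoD[OF tmono, of "Suc ?i" N] i by simp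
    have bnd: "(c + 2) * a \<le> (c + 2) * e" if "a \<le> \<eta> ?i" for a
      using that \<eta>i c(2) by simp
    have 1: "dist (p (Suc ?i)) (x s) \<le> (c + 2) * e"
      using lip[of s "t (Suc ?i)"] node[of "Suc ?i"] i tN s bnd[of "t (Suc ?i) - s"]
      by (simp add: dist_norm tSuc)
    have "dist (p ?i) (x s) \<le> (c + 2) * e"
      using lip[of "t ?i" s] node[of ?i] i tN tpos[of ?i] bnd[of "s - t ?i"]
      by (simp add: dist_norm norm_minus_commute tSuc)
    then have 2: "dist (fy (p ?i)) (x s) \<le> (c + 3) * e"
      using q(4) dist_triangle[of "fy (p ?i)" "x s" "p ?i"] by (simp add: algebra_simps)
    have "w p0 + t (Suc ?i) / 2 \<le> w (p (Suc ?i))" using inv[of "Suc ?i"] iT i by simp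
    then have 3: "s / 2 \<le> w (p (Suc ?i))" using i(3) quasi_Lyapunov_nonneg[OF w p0D] by simp
    show "p (Suc ?i) \<in> \<Union>(Green A) \<and> fy (p ?i) \<in> green_of A (p (Suc ?i)) \<and>
       fv (p ?i) \<in> green_map A (green_of A (p (Suc ?i))) (fy (p ?i)) \<and> dist (p (Suc ?i)) (x s) \<le> (c + 2) * e \<and>
       dist (fy (p ?i)) (x s) \<le> (c + 3) * e \<and> s / 2 \<le> w (p (Suc ?i))"
      unfolding eq using pG[of "Suc ?i"] i green_of(2)[OF A q(2)] q(3) 1 2 3 by simp
  next
    fix s s' :: real and S
    assume s: "0 \<le> s" "s < s'" "s' \<le> T" "convex S"
      and S: "\<And>\<tau>. s \<le> \<tau> \<Longrightarrow> \<tau> \<le> s' \<Longrightarrow> cball (fv (p (ix \<tau>))) (2 * e) \<subseteq> S"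
    show "(x s' - x s) /\<^sub>R (s' - s) \<in> S"
    proof (rule slope)
      fix i assume i: "i < N" "t i < s'" "s < t (Suc i)"
      \<comment> \<open>The hypothesis on \<open>S\<close> speaks of times, the slope estimate of
        steps; \<open>max s (t i)\<close> is a time of the i-th step that lies in
        \<open>[s, s']\<close>.\<close>
      have "ix (max s (t i)) = i" using i \<eta>0[of i] by (intro ix_eq) (auto simp: tSuc)
      then have "cball (fv (p i)) (2 * e) \<subseteq> S" using S[of "max s (t i)"] i s by simp
      moreover have iK: "p i \<in> K" using inK iT i by blast
      have "norm (u i - fv (p i)) \<le> 2 * e"
        using f[OF iK] iK pSuc[OF iK] by (simp add: R_def u_def \<eta>_def)
      ultimately show "u i \<in> S" by (auto simp: dist_norm norm_minus_commute)
    qed (use s TN in auto)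
  qed
qed

subsection \<open>Velocities of a limit of Euler polygons\<close>

text \<open>The nodes in \<open>U\<close> converge to \<open>x\<close>, so \<open>x\<close> runs in
  the closure of \<open>U\<close> and its derivative is tangent to it. Upper semicontinuity places
  the velocities near \<open>t\<close> in a convex neighbourhood of \<open>G_U(x(t))\<close>, whence
  the mean velocities lie there too, and so does their limit. A common vector of mapping and cone is
  close to \<open>F\<close>.\<close>

lemma velocity_in_green_map:
  fixes x :: "real \<Rightarrow> 'a::euclidean_space" and X P Y V :: "nat \<Rightarrow> real \<Rightarrow> 'a"
    and A :: "('i::wellorder, 'a) approximation"
  assumes A: "invariant_partial_approximation D F \<epsilon> A" and U: "U \<in> Green A" and t: "a < t" "t < b"
    and conv: "\<And>\<delta>. 0 < \<delta> \<Longrightarrow> \<exists>N. \<forall>n\<ge>N. \<forall>s\<in>{a..b}.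
      dist (X n s) (x s) < \<delta> \<and> dist (P n s) (x s) < \<delta> \<and> dist (Y n s) (x s) < \<delta> \<and> e n < \<delta>"
    and lab: "\<And>n s. s \<in> {a..b} \<Longrightarrow> P n s \<in> U \<and> Y n s \<in> U \<and> V n s \<in> green_map A U (Y n s)"
    and slope: "\<And>n s s' S. a \<le> s \<Longrightarrow> s < s' \<Longrightarrow> s' \<le> b \<Longrightarrow> convex S \<Longrightarrow>
       (\<And>\<tau>. s \<le> \<tau> \<Longrightarrow> \<tau> \<le> s' \<Longrightarrow> cball (V n \<tau>) (2 * e n) \<subseteq> S) \<Longrightarrow> (X n s' - X n s) /\<^sub>R (s' - s) \<in> S"
    and v: "(x has_vector_derivative v) (at t)"
  shows "\<exists>u\<in>F (x t). dist v u \<le> \<epsilon>"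
proof -
  have cl: "x s \<in> closure U" if "s \<in> {a..b}" for s
    unfolding closure_approachable
  proof (intro allI impI)
    fix \<delta> :: real assume "0 < \<delta>"
    then obtain N where "\<forall>n\<ge>N. \<forall>s\<in>{a..b}.
      dist (X n s) (x s) < \<delta> \<and> dist (P n s) (x s) < \<delta> \<and> dist (Y n s) (x s) < \<delta> \<and> e n < \<delta>"
      using conv by blast
    then have "dist (P N s) (x s) < \<delta>" using that by simp
    then show "\<exists>y\<in>U. dist y (x s) < \<delta>" using lab that by blast
  qed
  have tab: "t \<in> {a..b}" using t by simp
  \<comment> \<open>Decreasing positive times that keep \<open>t + q n\<close> in
    \<open>{a..b}\<close>. The same sequence witnesses tangency and computes
    \<open>v\<close>.\<close>
  define q where "q n = (b - t) / real (Suc n)" for n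
  have q: "0 < q n" "q n \<le> b - t" for n
    using t divide_left_mono[of 1 "real (Suc n)" "b - t"] by (simp_all add: q_def)
  have q0: "q \<longlonglongrightarrow> 0" unfolding q_def by (rule LIMSEQ_Suc[OF lim_const_over_n])
  have lim: "(\<lambda>n. (x (t + q n) - x t) /\<^sub>R q n) \<longlonglongrightarrow> v"
    unfolding lim_sequentially
  proof (intro allI impI)
    fix \<eta> :: real assume "0 < \<eta>"
    then obtain d where d: "d > 0"
      "\<And>s. norm (s - t) < d \<Longrightarrow> norm (x s - x t - (s - t) *\<^sub>R v) \<le> \<eta> / 2 * norm (s - t)"
      using v half_gt_zero[of \<eta>] unfolding has_vector_derivative_def has_derivative_at_alt by metis
    obtain N where N: "\<And>n. N \<le> n \<Longrightarrow> q n < d"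
      using order_tendstoD(2)[OF q0 d(1)] unfolding eventually_sequentially by blast
    have "dist ((x (t + q n) - x t) /\<^sub>R q n) v < \<eta>" if "N \<le> n" for n
    proof -
      have "norm (x (t + q n) - x t - q n *\<^sub>R v) \<le> \<eta> / 2 * q n"
        using d(2)[of "t + q n"] N[OF that] q(1)[of n] by simp
      moreover have "(x (t + q n) - x t) /\<^sub>R q n - v = (x (t + q n) - x t - q n *\<^sub>R v) /\<^sub>R q n"
        using q(1)[of n] by (simp add: scaleR_diff_right)
      then have "dist ((x (t + q n) - x t) /\<^sub>R q n) v = norm (x (t + q n) - x t - q n *\<^sub>R v) / q n"
        using q(1)[of n] by (simp add: dist_norm divide_inverse mult.commute)
      ultimately have "dist ((x (t + q n) - x t) /\<^sub>R q n) v \<le> \<eta> / 2"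
        using q(1)[of n] by (simp add: pos_divide_le_eq)
      then show ?thesis using \<open>0 < \<eta>\<close> by simp
    qed
    then show "\<exists>N. \<forall>n\<ge>N. dist ((x (t + q n) - x t) /\<^sub>R q n) v < \<eta>" by blast
  qed
  have tq: "t + q n \<in> {a..b}" for n using q[of n] t by simp
  have "v \<in> bouligand_cone (closure U) (x t)"
    unfolding bouligand_cone_def
  proof (intro CollectI exI conjI allI)
    show "x (t + q n) \<in> closure U" for n using cl tq by blast
    have "(\<lambda>n. t + q n) \<longlonglongrightarrow> t" using tendsto_add[OF tendsto_const q0] by simp
    then show "(\<lambda>n. x (t + q n)) \<longlonglongrightarrow> x t"
      using has_vector_derivative_continuous[OF v] isCont_tendsto_compose by blast
    show "decseq q" unfolding q_def decseq_def using t by (auto intro!: divide_left_mono)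
  qed (use q q0 lim in auto)
  moreover have "v \<in> green_map A U (x t)"
  proof -
    let ?G = "green_map A U (x t)"
    have G: "convex ?G" "compact ?G" using green_map_convex_compact[OF A U cl[OF tab]] by auto
    have "v \<in> closure ?G"
      unfolding closure_approachable_le
    proof (intro allI impI)
      fix \<eta> :: real assume "0 < \<eta>"
      \<comment> \<open>The closed \<open>\<eta>\<close>-neighbourhood of the values at
        \<open>x t\<close>: convex, so that it absorbs mean velocities, and compact, so that it is
        closed under both limits below.\<close>
      define S where "S = (\<Union>g\<in>?G. \<Union>b\<in>cball 0 \<eta>. {g + b})"
      have "convex S" unfolding S_def using G(1) convex_cball by (rule convex_sums)
      have "compact S"
      proof -
        have S: "S = {g + b | g b. g \<in> ?G \<and> b \<in> cball 0 \<eta>}" unfolding S_def by blast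
        show ?thesis unfolding S by (rule compact_sums[OF G(2) compact_cball])
      qed
      define W where "W = (\<Union>g\<in>?G. ball g (\<eta> / 2))"
      have "open W" "?G \<subseteq> W" using \<open>0 < \<eta>\<close> by (auto simp: W_def)
      then have "\<forall>\<^sub>F y in at (x t) within closure U. green_map A U y \<subseteq> W"
        using green_usc[OF A U] cl[OF tab] unfolding upper_semicontinuous_on_def by blast
      then obtain d where d: "d > 0" "\<And>y. y \<in> closure U \<Longrightarrow> dist y (x t) < d \<Longrightarrow> green_map A U y \<subseteq> W"
        unfolding eventually_at using \<open>?G \<subseteq> W\<close> by metis
      have "isCont x t" using has_vector_derivative_continuous[OF v] .
      then obtain d' where d': "d' > 0" "\<And>s. dist s t < d' \<Longrightarrow> dist (x s) (x t) < d / 2"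
        using d(1) unfolding continuous_at_eps_delta by (metis dist_commute half_gt_zero)
      \<comment> \<open>\<open>d / 2\<close> keeps \<open>Y n \<tau>\<close> within \<open>d\<close>
        of \<open>x t\<close>, where semicontinuity applies with error \<open>\<eta> / 2\<close>;
        \<open>\<eta> / 4\<close> leaves the other \<open>\<eta> / 2\<close> for the slope error
        \<open>2 * e n\<close>.\<close>
      have "0 < min (d / 2) (\<eta> / 4)" using d(1) \<open>0 < \<eta>\<close> by simp
      then obtain N where N: "\<And>n s. N \<le> n \<Longrightarrow> s \<in> {a..b} \<Longrightarrow>
          dist (Y n s) (x s) < min (d / 2) (\<eta> / 4) \<and> e n < min (d / 2) (\<eta> / 4)"
        using conv by metis
      have XS: "(X n s' - X n t) /\<^sub>R (s' - t) \<in> S" if n: "N \<le> n" and s': "t < s'" "s' \<le> b" "s' < t + d'" for n s'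
      proof (rule slope)
        fix \<tau> assume \<tau>: "t \<le> \<tau>" "\<tau> \<le> s'"
        then have \<tau>ab: "\<tau> \<in> {a..b}" using t s' by simp
        have "dist \<tau> t < d'" using \<tau> s' by (simp add: dist_real_def)
        then have "dist (Y n \<tau>) (x t) < d"
          using N[OF n \<tau>ab] d'(2)[of \<tau>] dist_triangle[of "Y n \<tau>" "x t" "x \<tau>"] by simp
        moreover have "Y n \<tau> \<in> closure U" using lab[OF \<tau>ab] closure_subset by blast
        ultimately have "V n \<tau> \<in> W" using d(2) lab[OF \<tau>ab] by blast
        then obtain g where g: "g \<in> ?G" "dist g (V n \<tau>) < \<eta> / 2" by (auto simp: W_def)
        show "cball (V n \<tau>) (2 * e n) \<subseteq> S"
        proof
          fix z assume "z \<in> cball (V n \<tau>) (2 * e n)"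
          then have "dist (V n \<tau>) z \<le> \<eta> / 2" using N[OF n \<tau>ab] by simp
          then have "norm (z - g) \<le> \<eta>"
            using g(2) dist_triangle[of g z "V n \<tau>"] by (simp add: dist_norm norm_minus_commute)
          then show "z \<in> S" unfolding S_def using g(1) by (intro UN_I[of g] UN_I[of "z - g"]) auto
        qed
      qed (use s' t \<open>convex S\<close> in auto)
      \<comment> \<open>The two limits are taken in turn: n tends to infinity for a fixed
        \<open>s'\<close>, and afterwards \<open>s'\<close> tends to \<open>t\<close>.\<close>
      have xS: "(x s' - x t) /\<^sub>R (s' - t) \<in> S" if s': "t < s'" "s' \<le> b" "s' < t + d'" for s'
      proof (rule closed_sequentially[OF compact_imp_closed[OF \<open>compact S\<close>]])
        have pw: "(\<lambda>n. X n s) \<longlonglongrightarrow> x s" if "s \<in> {a..b}" for s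
          unfolding lim_sequentially using conv that by meson
        show "(X (n + N) s' - X (n + N) t) /\<^sub>R (s' - t) \<in> S" for n using XS s' by simp
        show "(\<lambda>n. (X (n + N) s' - X (n + N) t) /\<^sub>R (s' - t)) \<longlonglongrightarrow> (x s' - x t) /\<^sub>R (s' - t)"
          using s' t by (intro tendsto_intros LIMSEQ_ignore_initial_segment pw) auto
      qed
      have "v \<in> S"
      proof (rule Lim_in_closed_set[OF compact_imp_closed[OF \<open>compact S\<close>] _ sequentially_bot lim])
        have "\<forall>\<^sub>F n in sequentially. q n < d'" using q0 d'(1) by (rule order_tendstoD(2))
        then show "\<forall>\<^sub>F n in sequentially. (x (t + q n) - x t) /\<^sub>R q n \<in> S"
        proof eventually_elim
          case (elim n)
          then show ?case using xS[of "t + q n"] q[of n] by simp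
        qed
      qed
      then obtain g b where "g \<in> ?G" "norm b \<le> \<eta>" "v = g + b" by (auto simp: S_def)
      then show "\<exists>g\<in>?G. dist g v \<le> \<eta>" by (intro bexI[of _ g]) (auto simp: dist_norm)
    qed
    then show ?thesis using compact_imp_closed[OF G(2)] by simp
  qed
  ultimately show ?thesis using green_map_cone_approx[OF A U cl[OF tab]] by blast
qed

text \<open>Local finiteness gives a finite set of green sets only near one point of the curve,
  hence a statement about a neighbourhood of \<open>t0\<close>. Exceptional times are jumps of a
  monotone function and so countable.\<close>

lemma velocity_near_values_locally:
  fixes x :: "real \<Rightarrow> 'a::euclidean_space" and X P Y V :: "nat \<Rightarrow> real \<Rightarrow> 'a"
    and A :: "('i::wellorder, 'a) approximation"
  assumes A: "invariant_partial_approximation D F \<epsilon> A"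
    and x: "continuous_on {0..T} x" and t0: "0 < t0" "t0 < T" and xG: "x t0 \<in> \<Union>(Green A)"
    and conv: "\<And>\<delta>. 0 < \<delta> \<Longrightarrow> \<exists>N. \<forall>n\<ge>N. \<forall>s\<in>{0..T}.
      dist (X n s) (x s) < \<delta> \<and> dist (P n s) (x s) < \<delta> \<and> dist (Y n s) (x s) < \<delta> \<and> e n < \<delta>"
    and lab: "\<And>n s. s \<in> {0..T} \<Longrightarrow> P n s \<in> \<Union>(Green A) \<and> Y n s \<in> green_of A (P n s) \<and>
       V n s \<in> green_map A (green_of A (P n s)) (Y n s)"
    and le: "\<And>n s s'. 0 \<le> s \<Longrightarrow> s \<le> s' \<Longrightarrow> s' \<le> T \<Longrightarrow> green_le A (P n s) (P n s')"
    and slope: "\<And>n s s' S. 0 \<le> s \<Longrightarrow> s < s' \<Longrightarrow> s' \<le> T \<Longrightarrow> convex S \<Longrightarrow>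
       (\<And>\<tau>. s \<le> \<tau> \<Longrightarrow> \<tau> \<le> s' \<Longrightarrow> cball (V n \<tau>) (2 * e n) \<subseteq> S) \<Longrightarrow> (X n s' - X n s) /\<^sub>R (s' - s) \<in> S"
  shows "\<exists>\<delta>>0. countable {t\<in>ball t0 \<delta>. \<exists>v. (x has_vector_derivative v) (at t) \<and> \<not> (\<exists>u\<in>F (x t). dist v u \<le> \<epsilon>)}"
proof -
  obtain W where W: "open W" "x t0 \<in> W" "finite {U \<in> Green A. U \<inter> W \<noteq> {}}"
    using green_locally_finite[OF A xG] by blast
  define \<S> where "\<S> = {U \<in> Green A. U \<inter> W \<noteq> {}}"
  have fin: "finite \<S>" using W by (simp add: \<S>_def)
  obtain \<rho> where \<rho>: "\<rho> > 0" "ball (x t0) \<rho> \<subseteq> W" using W open_contains_ball by blast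
  obtain d where d: "d > 0" "\<And>s. s \<in> {0..T} \<Longrightarrow> dist s t0 < d \<Longrightarrow> dist (x s) (x t0) < \<rho> / 2"
    using x t0 \<rho>(1) unfolding continuous_on_iff by (metis atLeastAtMost_iff half_gt_zero less_imp_le)
  obtain N where N: "\<And>n s. N \<le> n \<Longrightarrow> s \<in> {0..T} \<Longrightarrow> dist (P n s) (x s) < \<rho> / 2"
    using conv[OF half_gt_zero[OF \<rho>(1)]] by blast
  define \<delta> where "\<delta> = min d (min t0 (T - t0))"
  have "\<delta> > 0" using d t0 by (simp add: \<delta>_def)
  define I where "I = ball t0 \<delta>"
  have I: "I \<subseteq> {0<..<T}" "open I" by (auto simp: I_def \<delta>_def dist_real_def abs_if split: if_splits)
  \<comment> \<open>On \<open>I\<close> the curve stays within \<open>\<rho> / 2\<close> of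
    \<open>x t0\<close>, and for \<open>n \<ge> N\<close> the nodes stay within
    \<open>\<rho> / 2\<close> of the curve; so the nodes lie in \<open>W\<close>.\<close>
  have labS: "green_of A (P n s) \<in> \<S>" if "N \<le> n" "s \<in> I" for n s
  proof -
    have s: "s \<in> {0..T}" using I that by force
    have "dist (x s) (x t0) < \<rho> / 2" using d(2)[OF s] that by (simp add: I_def \<delta>_def dist_commute)
    then have "dist (x t0) (P n s) < \<rho>"
      using N[OF that(1) s] dist_triangle[of "x t0" "P n s" "x s"] by (simp add: dist_commute)
    then have "P n s \<in> W" using \<rho>(2) by auto
    then show ?thesis using green_of[OF A, of "P n s"] lab[OF s] unfolding \<S>_def by blast
  qed
  \<comment> \<open>The rank of the green set visited is nondecreasing in time. The smallest value \<open>g s\<close> that infinitely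
    many polygons do not exceed at time \<open>s\<close> is therefore monotone and has only countably many jumps;
    between them infinitely many polygons stay in one green set.\<close>
  define r where "r n s = card {U\<in>\<S>. green_less A U (green_of A (P n s))}" for n s
  have r_mono: "r n s \<le> r n s'" and r_eq: "r n s = r n s' \<Longrightarrow> green_of A (P n s) = green_of A (P n s')"
    if "N \<le> n" "s \<in> I" "s' \<in> I" "s \<le> s'" for n s s'
  proof -
    have ss: "s \<in> {0..T}" "s' \<in> {0..T}" using I that by force+
    have ne: "green_of A (P n s) \<noteq> {}" using lab[OF ss(1), of n] by blast
    have *: "green_of A (P n s) = green_of A (P n s') \<or> r n s < r n s'"
    proof (cases "green_of A (P n s) = green_of A (P n s')")
      case False
      then have less: "green_less A (green_of A (P n s)) (green_of A (P n s'))"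
        using le[of s s' n] ss that unfolding green_le_def by simp
      let ?R = "\<lambda>s. {U\<in>\<S>. green_less A U (green_of A (P n s))}"
      have "?R s \<subseteq> ?R s'"
      proof
        fix U assume U: "U \<in> ?R s"
        then have "U \<noteq> {}" unfolding \<S>_def by blast
        then show "U \<in> ?R s'" using U green_less_trans[OF A _ less ne] by blast
      qed
      moreover have "green_of A (P n s) \<in> ?R s'" using less labS that by simp
      moreover have "green_of A (P n s) \<notin> ?R s" unfolding green_less_def by simp
      ultimately have "?R s \<subset> ?R s'" by blast
      then show ?thesis unfolding r_def using fin by (intro disjI2 psubset_card_mono) auto
    qed simp
    then show "r n s \<le> r n s'" by (auto simp: r_def)
    show "r n s = r n s' \<Longrightarrow> green_of A (P n s) = green_of A (P n s')" using * by simp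
  qed
  define g where "g s = (LEAST m. \<exists>\<^sub>\<infinity>n. r n s \<le> m)" for s
  have "\<exists>m. \<exists>\<^sub>\<infinity>n. r n s \<le> m" for s
  proof -
    have "r n s \<le> card \<S>" for n unfolding r_def using fin by (intro card_mono) auto
    then show ?thesis by (intro exI[of _ "card \<S>"]) simp
  qed
  then have g1: "\<exists>\<^sub>\<infinity>n. r n s \<le> g s" for s unfolding g_def by (rule LeastI_ex)
  have g2: "g s \<le> m" if "\<exists>\<^sub>\<infinity>n. r n s \<le> m" for s m unfolding g_def using that by (rule Least_le)
  have largeN: "\<forall>\<^sub>\<infinity>n. N \<le> n" unfolding cofinite_eq_sequentially by (rule eventually_ge_at_top)
  have "g s \<le> g s'" if "s \<in> I" "s' \<in> I" "s \<le> s'" for s s'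
  proof (rule g2)
    from largeN have "\<forall>\<^sub>\<infinity>n. r n s' \<le> g s' \<longrightarrow> r n s \<le> g s'"
      by eventually_elim (use r_mono that order_trans in blast)
    then show "\<exists>\<^sub>\<infinity>n. r n s \<le> g s'" using g1 by (rule frequently_mp)
  qed
  then have "mono_on I (\<lambda>s. real (g s))" by (intro mono_onI) auto
  then have "countable {t\<in>I. \<not> isCont (\<lambda>s. real (g s)) t}"
    using I(2) by (intro mono_on_ctble_discont_open)
  moreover have "\<exists>u\<in>F (x t). dist v u \<le> \<epsilon>"
    if t: "t \<in> I" and cont: "isCont (\<lambda>s. real (g s)) t" and v: "(x has_vector_derivative v) (at t)" for t v
  proof -
    \<comment> \<open>\<open>g\<close> takes integer values, so near a point of continuity it is
      constant: variation below 1 is no variation.\<close>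
    obtain d1 where d1: "d1 > 0" "\<And>s. dist s t < d1 \<Longrightarrow> dist (real (g s)) (real (g t)) < 1"
      using cont zero_less_one unfolding continuous_at_eps_delta by blast
    obtain d2 where d2: "d2 > 0" "cball t d2 \<subseteq> I" using I(2) t open_contains_cball by blast
    define \<kappa> where "\<kappa> = min (d1 / 2) d2"
    define a where "a = t - \<kappa>"
    define b where "b = t + \<kappa>"
    have \<kappa>d1: "\<kappa> < d1" using d1(1) by (simp add: \<kappa>_def min_less_iff_disj)
    have "\<kappa> > 0" using d1 d2 by (simp add: \<kappa>_def)
    have abI: "{a..b} \<subseteq> I" using d2(2) by (rule subset_trans[rotated]) (auto simp: a_def b_def \<kappa>_def dist_real_def)
    have ab: "a \<in> I" "b \<in> I" using abI \<open>\<kappa> > 0\<close> by (auto simp: a_def b_def subset_eq)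
    \<comment> \<open>Minimality of \<open>g a\<close> gives \<open>g t \<le> r n a\<close> for all
      large n, and the definition of \<open>g b\<close> gives \<open>r n b \<le> g t\<close> for
      infinitely many n. For the common n the rank is squeezed to \<open>g t\<close> on all of
      \<open>{a..b}\<close>.\<close>
    have gab: "g a = g t" "g b = g t"
      using d1(2)[of a] d1(2)[of b] \<open>\<kappa> > 0\<close> \<kappa>d1 by (simp_all add: a_def b_def dist_real_def)
    have "\<forall>\<^sub>\<infinity>n. g t \<le> r n a"
    proof (rule ccontr)
      assume "\<not> (\<forall>\<^sub>\<infinity>n. g t \<le> r n a)"
      then have "\<exists>\<^sub>\<infinity>n. r n a < g t" by (simp add: not_le)
      then have "\<exists>\<^sub>\<infinity>n. r n a \<le> g t - 1" by (rule INFM_mono) simp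
      then have "g t \<le> g t - 1" using g2[of a] gab by simp
      moreover have "0 < g t" using \<open>\<exists>\<^sub>\<infinity>n. r n a < g t\<close> by (auto dest: INFM_EX)
      ultimately show False by simp
    qed
    with largeN have "\<forall>\<^sub>\<infinity>n. r n b \<le> g b \<longrightarrow> N \<le> n \<and> g t \<le> r n a \<and> r n b \<le> g t"
      by eventually_elim (simp add: gab)
    then have "\<exists>\<^sub>\<infinity>n. N \<le> n \<and> g t \<le> r n a \<and> r n b \<le> g t" using g1[of b] by (rule frequently_mp)
    then have inf: "infinite {n. N \<le> n \<and> g t \<le> r n a \<and> r n b \<le> g t}" (is "infinite ?J")
      unfolding INFM_iff_infinite .
    \<comment> \<open>Each of these polygons stays in one green set during \<open>{a..b}\<close>,
      but the set may depend on n. As \<open>\<S>\<close> is finite, infinitely many of them share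
      the same \<open>U\<close>.\<close>
    have "(\<lambda>n. green_of A (P n a)) ` ?J \<subseteq> \<S>" using labS ab by blast
    then obtain m where m: "m \<in> ?J" "infinite {n\<in>?J. green_of A (P n a) = green_of A (P m a)}" (is "infinite ?J'")
      using pigeonhole_infinite[OF inf] fin finite_subset by blast
    define U where "U = green_of A (P m a)"
    define \<sigma> where "\<sigma> = enumerate ?J'"
    have \<sigma>: "\<sigma> n \<in> ?J'" "n \<le> \<sigma> n" for n
      using enumerate_in_set[OF m(2)] le_enumerate[OF m(2)] by (auto simp: \<sigma>_def)
    have UG: "U \<in> Green A" using labS[of m a] m(1) ab unfolding U_def \<S>_def by blast
    have const: "green_of A (P (\<sigma> n) s) = U" if s: "s \<in> {a..b}" for n s
    proof -
      have n: "N \<le> \<sigma> n" "g t \<le> r (\<sigma> n) a" "r (\<sigma> n) b \<le> g t" "green_of A (P (\<sigma> n) a) = U"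
        using \<sigma>(1)[of n] unfolding U_def by simp_all
      have "r (\<sigma> n) a \<le> r (\<sigma> n) s" "r (\<sigma> n) s \<le> r (\<sigma> n) b"
        using r_mono[OF n(1)] s abI ab by auto
      then have "r (\<sigma> n) a = r (\<sigma> n) s" using n by simp
      then show ?thesis using r_eq[OF n(1), of a s] s abI ab n(4) by auto
    qed
    have abT: "0 \<le> a" "b \<le> T" using ab I by (auto simp: subset_eq less_imp_le)
    have atb: "a < t" "t < b" using \<open>\<kappa> > 0\<close> by (auto simp: a_def b_def)
    show ?thesis
    proof (rule velocity_in_green_map[OF A UG atb, of "\<lambda>n. X (\<sigma> n)" x "\<lambda>n. P (\<sigma> n)" "\<lambda>n. Y (\<sigma> n)" "\<lambda>n. e (\<sigma> n)" "\<lambda>n. V (\<sigma> n)"])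
      fix \<eta> :: real assume "0 < \<eta>"
      then obtain M where M: "\<forall>n\<ge>M. \<forall>s\<in>{0..T}. dist (X n s) (x s) < \<eta> \<and> dist (P n s) (x s) < \<eta> \<and> dist (Y n s) (x s) < \<eta> \<and> e n < \<eta>"
        using conv by blast
      show "\<exists>N. \<forall>n\<ge>N. \<forall>s\<in>{a..b}. dist (X (\<sigma> n) s) (x s) < \<eta> \<and> dist (P (\<sigma> n) s) (x s) < \<eta> \<and>
          dist (Y (\<sigma> n) s) (x s) < \<eta> \<and> e (\<sigma> n) < \<eta>"
      proof (intro exI allI impI ballI)
        fix n s assume "M \<le> n" "s \<in> {a..b}"
        then have "M \<le> \<sigma> n" "s \<in> {0..T}" using \<sigma>(2)[of n] abT by auto
        with M show "dist (X (\<sigma> n) s) (x s) < \<eta> \<and> dist (P (\<sigma> n) s) (x s) < \<eta> \<and>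
          dist (Y (\<sigma> n) s) (x s) < \<eta> \<and> e (\<sigma> n) < \<eta>" by blast
      qed
    next
      fix n s assume s: "s \<in> {a..b}"
      then have sT: "s \<in> {0..T}" using abT by simp
      note l = lab[OF sT, of "\<sigma> n"]
      have "P (\<sigma> n) s \<in> green_of A (P (\<sigma> n) s)" using green_of(2)[OF A] l by blast
      then show "P (\<sigma> n) s \<in> U \<and> Y (\<sigma> n) s \<in> U \<and> V (\<sigma> n) s \<in> green_map A U (Y (\<sigma> n) s)"
        using l unfolding const[OF s] by blast
    qed (use slope abT v in auto)
  qed
  then have "{t\<in>I. \<exists>v. (x has_vector_derivative v) (at t) \<and> \<not> (\<exists>u\<in>F (x t). dist v u \<le> \<epsilon>)}
      \<subseteq> {t\<in>I. \<not> isCont (\<lambda>s. real (g s)) t}" by blast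
  ultimately have "countable {t\<in>I. \<exists>v. (x has_vector_derivative v) (at t) \<and> \<not> (\<exists>u\<in>F (x t). dist v u \<le> \<epsilon>)}"
    using countable_subset by blast
  then show ?thesis using \<open>\<delta> > 0\<close> unfolding I_def by blast
qed

text \<open>Each exceptional time has a neighbourhood with only countably many others, and
  negligibility is a local property.\<close>

lemma velocity_near_values_ae:
  fixes x :: "real \<Rightarrow> 'a::euclidean_space" and X P Y V :: "nat \<Rightarrow> real \<Rightarrow> 'a"
    and A :: "('i::wellorder, 'a) approximation"
  assumes A: "invariant_partial_approximation D F \<epsilon> A"
    and x: "continuous_on {0..T} x" and xG: "\<And>t. 0 < t \<Longrightarrow> t < T \<Longrightarrow> x t \<in> \<Union>(Green A)"
    and conv: "\<And>\<delta>. 0 < \<delta> \<Longrightarrow> \<exists>N. \<forall>n\<ge>N. \<forall>s\<in>{0..T}.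
      dist (X n s) (x s) < \<delta> \<and> dist (P n s) (x s) < \<delta> \<and> dist (Y n s) (x s) < \<delta> \<and> e n < \<delta>"
    and lab: "\<And>n s. s \<in> {0..T} \<Longrightarrow> P n s \<in> \<Union>(Green A) \<and> Y n s \<in> green_of A (P n s) \<and>
       V n s \<in> green_map A (green_of A (P n s)) (Y n s)"
    and le: "\<And>n s s'. 0 \<le> s \<Longrightarrow> s \<le> s' \<Longrightarrow> s' \<le> T \<Longrightarrow> green_le A (P n s) (P n s')"
    and slope: "\<And>n s s' S. 0 \<le> s \<Longrightarrow> s < s' \<Longrightarrow> s' \<le> T \<Longrightarrow> convex S \<Longrightarrow>
       (\<And>\<tau>. s \<le> \<tau> \<Longrightarrow> \<tau> \<le> s' \<Longrightarrow> cball (V n \<tau>) (2 * e n) \<subseteq> S) \<Longrightarrow> (X n s' - X n s) /\<^sub>R (s' - s) \<in> S"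
  shows "negligible {t\<in>{0<..<T}. \<exists>v. (x has_vector_derivative v) (at t) \<and> \<not> (\<exists>u\<in>F (x t). dist v u \<le> \<epsilon>)}"
    (is "negligible ?B")
proof (rule iffD2[OF locally_negligible_alt], rule ballI)
  fix t0 assume t0: "t0 \<in> ?B"
  then have "0 < t0" "t0 < T" by auto
  have "\<exists>\<delta>>0. countable {t\<in>ball t0 \<delta>. \<exists>v. (x has_vector_derivative v) (at t) \<and> \<not> (\<exists>u\<in>F (x t). dist v u \<le> \<epsilon>)}"
    by (rule velocity_near_values_locally[OF A x \<open>0 < t0\<close> \<open>t0 < T\<close> xG[OF \<open>0 < t0\<close> \<open>t0 < T\<close>],
          of X P Y e V, OF conv lab le slope])
  then obtain \<delta> where \<delta>: "\<delta> > 0"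
    "countable {t\<in>ball t0 \<delta>. \<exists>v. (x has_vector_derivative v) (at t) \<and> \<not> (\<exists>u\<in>F (x t). dist v u \<le> \<epsilon>)}"
    by blast
  have "?B \<inter> ball t0 \<delta> \<subseteq> {t\<in>ball t0 \<delta>. \<exists>v. (x has_vector_derivative v) (at t) \<and> \<not> (\<exists>u\<in>F (x t). dist v u \<le> \<epsilon>)}"
    by blast
  then have "countable (?B \<inter> ball t0 \<delta>)" using \<delta>(2) by (rule countable_subset)
  then have "negligible (?B \<inter> ball t0 \<delta>)"
    unfolding negligible_iff_null_sets by (intro null_sets_completionI countable_imp_null_set_lborel)
  moreover have "openin (top_of_set ?B) (?B \<inter> ball t0 \<delta>)" by (simp add: openin_open_Int)
  moreover have "t0 \<in> ?B \<inter> ball t0 \<delta>" using t0 \<delta>(1) by simp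
  ultimately show "\<exists>U. openin (top_of_set ?B) U \<and> t0 \<in> U \<and> negligible U" by blast
qed

section \<open>Compactness and passage to the limit\<close>

lemma locally_closed_imp_compact_Int_cball:
  fixes D :: "'a::euclidean_space set"
  assumes "locally_closed D" "x0 \<in> D"
  obtains r where "0 < r" "compact (D \<inter> cball x0 r)"
proof -
  obtain S B where D: "open S" "closed B" "D = S \<inter> B" using assms(1) unfolding locally_closed_def by blast
  then obtain r where r: "0 < r" "cball x0 r \<subseteq> S" using assms(2) open_contains_cball by blast
  then have "D \<inter> cball x0 r = cball x0 r \<inter> B" using D by blast
  then have "compact (D \<inter> cball x0 r)" using D(2) compact_Int_closed compact_cball by metis
  with r(1) show ?thesis by (rule that)
qed

lemma Lipschitz_imp_absolutely_continuous_on_interval: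
  assumes lip: "\<And>s t. a \<le> s \<Longrightarrow> s \<le> t \<Longrightarrow> t \<le> b \<Longrightarrow> dist (f s) (f t) \<le> L * (t - s)" and L: "0 < L"
  shows "absolutely_continuous_on_interval a b f"
  unfolding absolutely_continuous_on_interval_def
proof (intro allI impI)
  fix \<epsilon> :: real assume "0 < \<epsilon>"
  show "\<exists>\<delta>>0. \<forall>(n::nat) s t.
        (\<forall>i<n. a \<le> s i \<and> s i \<le> t i \<and> t i \<le> b) \<and>
        (\<forall>i<n. \<forall>j<n. i \<noteq> j \<longrightarrow> {s i<..<t i} \<inter> {s j<..<t j} = {}) \<and>
        (\<Sum>i<n. t i - s i) < \<delta> \<longrightarrow>
        (\<Sum>i<n. dist (f (s i)) (f (t i))) < \<epsilon>"
  proof (intro exI[of _ "\<epsilon> / L"] conjI allI impI)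
    fix n :: nat and s t
    assume *: "(\<forall>i<n. a \<le> s i \<and> s i \<le> t i \<and> t i \<le> b) \<and>
        (\<forall>i<n. \<forall>j<n. i \<noteq> j \<longrightarrow> {s i<..<t i} \<inter> {s j<..<t j} = {}) \<and> (\<Sum>i<n. t i - s i) < \<epsilon> / L"
    have "(\<Sum>i<n. dist (f (s i)) (f (t i))) \<le> (\<Sum>i<n. L * (t i - s i))"
      by (rule sum_mono) (use * lip in auto)
    also have "\<dots> = L * (\<Sum>i<n. t i - s i)" by (simp add: sum_distrib_left)
    also have "\<dots> < L * (\<epsilon> / L)" using * L by (intro mult_strict_left_mono) auto
    finally show "(\<Sum>i<n. dist (f (s i)) (f (t i))) < \<epsilon>" using L by simp
  qed (use \<open>0 < \<epsilon>\<close> L in simp)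
qed

theorem theorem3p3:
  fixes D :: "'a::euclidean_space set"
    and F :: "'a \<Rightarrow> 'a set"
    and A :: "nat \<Rightarrow> ('i::wellorder, 'a) approximation"
    and w :: "nat \<Rightarrow> 'a \<Rightarrow> real"
    and x0 :: 'a
  assumes "locally_closed D"
    and "uniformly_bounded_on (closure D) F"
    and "\<And>x. x \<in> closure D \<Longrightarrow> F x \<noteq> {} \<and> closed (F x)"
    and "\<And>k. 1 \<le> k \<Longrightarrow> invariant_partial_approximation D F (1 / real k) (A k)"
    and "\<And>k. 1 \<le> k \<Longrightarrow>
           approximation_refines (1 / real (Suc k)) (A (Suc k)) (1 / real k) (A k)"
    and "\<And>k. 1 \<le> k \<Longrightarrow> quasi_Lyapunov D (A k) (w k)"
    and "\<And>k1 k2 x. 1 \<le> k1 \<Longrightarrow> k1 \<le> k2 \<Longrightarrow> x \<in> D \<Longrightarrow> w k2 x \<le> w k1 x"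
    and "x0 \<in> D \<inter> (\<Inter>k\<in>{1..}. closure (\<Union>(Green (A k))))"
  shows "\<exists>T>0. \<exists>x :: real \<Rightarrow> 'a.
           x ` {0..T} \<subseteq> D \<and>
           absolutely_continuous_on_interval 0 T x \<and>
           x 0 = x0 \<and>
           (AE t in lebesgue_on {0..T}.
              \<exists>v. (x has_vector_derivative v) (at t within {0..T}) \<and> v \<in> F (x t))"
proof -
  have x0D: "x0 \<in> D" and x0cl: "\<And>k. 1 \<le> k \<Longrightarrow> x0 \<in> closure (\<Union>(Green (A k)))" using assms(8) by auto
  obtain r where r: "0 < r" "compact (D \<inter> cball x0 r)"
    using locally_closed_imp_compact_Int_cball[OF assms(1) x0D] .
  obtain c where c: "0 < c" "\<forall>x\<in>closure D. \<forall>v\<in>F x. norm v \<le> c"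
    using assms(2) unfolding uniformly_bounded_on_def by blast
  obtain M where M: "c + 2 = M" "0 < M" using c(1) by simp
  \<comment> \<open>Starting within \<open>r / 4\<close> of \<open>x0\<close> and travelling at most
    \<open>r / 4\<close>, the polygons remain within \<open>r / 2\<close> of \<open>x0\<close>. The
    other half of \<open>r\<close> is room for the nodes.\<close>
  define T where "T = r / 4 / M"
  have T: "0 < T" "(c + 2) * T = r / 4" unfolding M(1) using r(1) M(2) by (simp_all add: T_def)
  have ref: "green_refines (A j) (A k)" if "1 \<le> k" "k \<le> j" for j k
  proof (rule green_refines_chain[OF _ that])
    show "green_refines (A (Suc k)) (A k)" if "1 \<le> k" for k
      by (rule approximation_refines_imp_green_refines[OF assms(4)[OF that] assms(4) assms(5)[OF that]]) simp
  qed
  \<comment> \<open>The shift by 4 gives the bound \<open>1 / 4\<close> required of the step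
    accuracy. The n-th polygon uses level \<open>Suc n\<close>, since levels start at 1.\<close>
  define e :: "nat \<Rightarrow> real" where "e n = 1 / real (n + 4)" for n
  have e: "0 < e n" "e n \<le> 1 / 4" for n by (simp_all add: e_def field_simps)
  have e0: "e \<longlonglongrightarrow> 0"
    unfolding e_def by (rule LIMSEQ_ignore_initial_segment[OF lim_1_over_n])
  define E where "E n p x P Y V \<longleftrightarrow>
      p \<in> \<Union>(Green (A (Suc n))) \<and> dist p x0 < min (r / 4) (e n) \<and> x 0 = p \<and>
      (\<forall>s s'. 0 \<le> s \<longrightarrow> s \<le> s' \<longrightarrow> s' \<le> T \<longrightarrow> norm (x s' - x s) \<le> (c + 2) * (s' - s)) \<and>
      (\<forall>s. 0 \<le> s \<longrightarrow> s \<le> T \<longrightarrow> P s \<in> \<Union>(Green (A (Suc n))) \<and> Y s \<in> green_of (A (Suc n)) (P s) \<and>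
        V s \<in> green_map (A (Suc n)) (green_of (A (Suc n)) (P s)) (Y s) \<and> dist (P s) (x s) \<le> (c + 2) * e n \<and>
        dist (Y s) (x s) \<le> (c + 3) * e n \<and> s / 2 \<le> w (Suc n) (P s)) \<and>
      (\<forall>s s'. 0 \<le> s \<longrightarrow> s \<le> s' \<longrightarrow> s' \<le> T \<longrightarrow> green_le (A (Suc n)) (P s) (P s')) \<and>
      (\<forall>s s' S. 0 \<le> s \<longrightarrow> s < s' \<longrightarrow> s' \<le> T \<longrightarrow> convex S \<longrightarrow>
        (\<forall>\<tau>. s \<le> \<tau> \<longrightarrow> \<tau> \<le> s' \<longrightarrow> cball (V \<tau>) (2 * e n) \<subseteq> S) \<longrightarrow> (x s' - x s) /\<^sub>R (s' - s) \<in> S)"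
    for n p x P Y V
  have "\<exists>p x P Y V. E n p x P Y V" for n
  proof -
    have k: "1 \<le> Suc n" by simp
    have "0 < min (r / 4) (e n)" using r(1) e by simp
    then obtain p where p: "p \<in> \<Union>(Green (A (Suc n)))" "dist p x0 < min (r / 4) (e n)"
      using x0cl[OF k] unfolding closure_approachable by blast
    have hyps: "dist p x0 \<le> r / 2" "0 \<le> T" "(c + 2) * T \<le> r / 2" "1 / real (Suc n) \<le> 1" using p(2) T r(1) by auto
    show ?thesis
    proof (rule Euler_polygon[OF assms(4)[OF k] assms(6)[OF k] c(2,1) hyps(4) r(2) p(1) hyps(1-3) e])
      fix x P Y V
      assume "\<And>s s'. 0 \<le> s \<Longrightarrow> s \<le> s' \<Longrightarrow> s' \<le> T \<Longrightarrow> norm (x s' - x s) \<le> (c + 2) * (s' - s)" "x 0 = p"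
        "\<And>s. 0 \<le> s \<Longrightarrow> s \<le> T \<Longrightarrow> P s \<in> \<Union>(Green (A (Suc n))) \<and> Y s \<in> green_of (A (Suc n)) (P s) \<and>
          V s \<in> green_map (A (Suc n)) (green_of (A (Suc n)) (P s)) (Y s) \<and> dist (P s) (x s) \<le> (c + 2) * e n \<and>
          dist (Y s) (x s) \<le> (c + 3) * e n \<and> s / 2 \<le> w (Suc n) (P s)"
        "\<And>s s'. 0 \<le> s \<Longrightarrow> s \<le> s' \<Longrightarrow> s' \<le> T \<Longrightarrow> green_le (A (Suc n)) (P s) (P s')"
        "\<And>s s' S. 0 \<le> s \<Longrightarrow> s < s' \<Longrightarrow> s' \<le> T \<Longrightarrow> convex S \<Longrightarrow>
          (\<And>\<tau>. s \<le> \<tau> \<Longrightarrow> \<tau> \<le> s' \<Longrightarrow> cball (V \<tau>) (2 * e n) \<subseteq> S) \<Longrightarrow> (x s' - x s) /\<^sub>R (s' - s) \<in> S"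
      then have "E n p x P Y V" unfolding E_def using p by simp
      then show ?thesis by blast
    qed
  qed
  then obtain p X P Y V where "\<And>n. E n (p n) (X n) (P n) (Y n) (V n)" by metis
  note E = this[unfolded E_def]
  have pG: "p n \<in> \<Union>(Green (A (Suc n)))" and px0: "dist (p n) x0 < min (r / 4) (e n)" and X0: "X n 0 = p n"
    and lip: "\<And>s s'. 0 \<le> s \<Longrightarrow> s \<le> s' \<Longrightarrow> s' \<le> T \<Longrightarrow> norm (X n s' - X n s) \<le> (c + 2) * (s' - s)"
    and lab: "\<And>s. 0 \<le> s \<Longrightarrow> s \<le> T \<Longrightarrow> P n s \<in> \<Union>(Green (A (Suc n))) \<and> Y n s \<in> green_of (A (Suc n)) (P n s) \<and>
        V n s \<in> green_map (A (Suc n)) (green_of (A (Suc n)) (P n s)) (Y n s) \<and> dist (P n s) (X n s) \<le> (c + 2) * e n \<and>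
        dist (Y n s) (X n s) \<le> (c + 3) * e n \<and> s / 2 \<le> w (Suc n) (P n s)"
    and le: "\<And>s s'. 0 \<le> s \<Longrightarrow> s \<le> s' \<Longrightarrow> s' \<le> T \<Longrightarrow> green_le (A (Suc n)) (P n s) (P n s')"
    for n using E[of n] by simp_all
  have slope: "(X n s' - X n s) /\<^sub>R (s' - s) \<in> S"
    if "0 \<le> s" "s < s'" "s' \<le> T" "convex S" "\<And>\<tau>. s \<le> \<tau> \<Longrightarrow> \<tau> \<le> s' \<Longrightarrow> cball (V n \<tau>) (2 * e n) \<subseteq> S" for n s s' S
    using E[of n] that by simp
  have lip': "norm (X n s' - X n s) \<le> (c + 2) * \<bar>s' - s\<bar>" if "s \<in> {0..T}" "s' \<in> {0..T}" for n s s'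
    using lip[of s s' n] lip[of s' s n] that by (cases "s \<le> s'") (auto simp: norm_minus_commute)
  have Xx0: "dist (X n s) x0 \<le> r / 4 + r / 4" if "s \<in> {0..T}" for n s
  proof -
    have "norm (X n s - X n 0) \<le> (c + 2) * s" using lip[of 0 s n] that by simp
    also have "\<dots> \<le> (c + 2) * T" using that c(1) by simp
    finally show ?thesis
      using px0[of n] dist_triangle[of "X n s" x0 "p n"] T(2) X0 by (simp add: dist_norm)
  qed
  obtain x \<sigma> where x: "continuous_on {0..T} x" and \<sigma>: "strict_mono (\<sigma> :: nat \<Rightarrow> nat)"
    and lim: "\<And>\<eta>. 0 < \<eta> \<Longrightarrow> \<exists>N. \<forall>n s. n \<ge> N \<and> s \<in> {0..T} \<longrightarrow> norm (X (\<sigma> n) s - x s) < \<eta>"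
  proof (rule Arzela_Ascoli[of "{0..T}" X "norm x0 + r"])
    show "norm (X n s) \<le> norm x0 + r" if "s \<in> {0..T}" for n s
      using Xx0[OF that, of n] norm_triangle_sub[of "X n s" x0] r(1) by (simp add: dist_norm)
    show "\<exists>d>0. \<forall>n s'. s' \<in> {0..T} \<and> norm (s - s') < d \<longrightarrow> norm (X n s - X n s') < \<eta>"
      if "s \<in> {0..T}" "0 < \<eta>" for s \<eta>
    proof (intro exI[of _ "\<eta> / (c + 2)"] conjI allI impI)
      fix n s' assume "s' \<in> {0..T} \<and> norm (s - s') < \<eta> / (c + 2)"
      moreover from this have "(c + 2) * \<bar>s - s'\<bar> < \<eta>" using c(1) by (simp add: pos_less_divide_eq mult.commute)
      ultimately show "norm (X n s - X n s') < \<eta>" using lip'[of s' s n] that by simp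
    qed (use that c(1) in simp)
  qed auto
  have \<sigma>n: "n \<le> \<sigma> n" for n using \<sigma> by (rule seq_suble)
  have conv: "\<exists>N. \<forall>n\<ge>N. \<forall>s\<in>{0..T}. dist (X (\<sigma> n) s) (x s) < \<eta> \<and> dist (P (\<sigma> n) s) (x s) < \<eta> \<and>
      dist (Y (\<sigma> n) s) (x s) < \<eta> \<and> e (\<sigma> n) < \<eta>" if "0 < \<eta>" for \<eta>
  proof -
    have "0 < \<eta> / 2" using that by simp
    from lim[OF this] obtain N1 where N1: "\<forall>n s. n \<ge> N1 \<and> s \<in> {0..T} \<longrightarrow> norm (X (\<sigma> n) s - x s) < \<eta> / 2"
      by blast
    have "0 < \<eta> / 2 / (c + 3)" using that c(1) by simp
    then obtain N2 where N2: "\<And>n. n \<ge> N2 \<Longrightarrow> e n < \<eta> / 2 / (c + 3)"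
      using order_tendstoD(2)[OF e0] unfolding eventually_sequentially by blast
    show ?thesis
    proof (intro exI[of _ "max N1 N2"] allI impI ballI)
      fix n s assume n: "max N1 N2 \<le> n" and s: "s \<in> {0..T}"
      have 1: "dist (X (\<sigma> n) s) (x s) < \<eta> / 2" using N1 n s by (simp add: dist_norm)
      have "e (\<sigma> n) < \<eta> / 2 / (c + 3)" using N2[of "\<sigma> n"] \<sigma>n[of n] n by simp
      then have 2: "(c + 3) * e (\<sigma> n) < \<eta> / 2" using c(1) by (simp add: pos_less_divide_eq algebra_simps)
      have 3: "(c + 2) * e (\<sigma> n) \<le> (c + 3) * e (\<sigma> n)" "1 * e (\<sigma> n) \<le> (c + 3) * e (\<sigma> n)"
        using e(1)[of "\<sigma> n"] c(1) by (intro mult_right_mono; simp)+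
      have 4: "dist (P (\<sigma> n) s) (X (\<sigma> n) s) \<le> (c + 2) * e (\<sigma> n)" "dist (Y (\<sigma> n) s) (X (\<sigma> n) s) \<le> (c + 3) * e (\<sigma> n)"
        using lab[of s "\<sigma> n"] s by auto
      have "dist (X (\<sigma> n) s) (x s) < \<eta>" using 1 that by linarith
      moreover have "dist (P (\<sigma> n) s) (x s) < \<eta>"
        using 1 2 3(1) 4(1) dist_triangle[of "P (\<sigma> n) s" "x s" "X (\<sigma> n) s"] by linarith
      moreover have "dist (Y (\<sigma> n) s) (x s) < \<eta>"
        using 1 2 4(2) dist_triangle[of "Y (\<sigma> n) s" "x s" "X (\<sigma> n) s"] by linarith
      moreover have "e (\<sigma> n) < \<eta>" using 2 3(2) that by linarith
      ultimately show "dist (X (\<sigma> n) s) (x s) < \<eta> \<and> dist (P (\<sigma> n) s) (x s) < \<eta> \<and>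
          dist (Y (\<sigma> n) s) (x s) < \<eta> \<and> e (\<sigma> n) < \<eta>" by blast
    qed
  qed
  have Xlim: "(\<lambda>n. X (\<sigma> n) s) \<longlonglongrightarrow> x s" and Plim: "(\<lambda>n. P (\<sigma> n) s) \<longlonglongrightarrow> x s" if "s \<in> {0..T}" for s
    unfolding lim_sequentially using conv that by meson+
  have xlip: "norm (x s' - x s) \<le> (c + 2) * \<bar>s' - s\<bar>" if "s \<in> {0..T}" "s' \<in> {0..T}" for s s'
    using tendsto_norm[OF tendsto_diff[OF Xlim[OF that(2)] Xlim[OF that(1)]]]
    by (rule LIMSEQ_le_const2) (use lip' that in blast)
  have "x 0 = x0"
  proof -
    have "(\<lambda>n. p (\<sigma> n)) \<longlonglongrightarrow> x0"
    proof (rule metric_tendsto_imp_tendsto)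
      show "(\<lambda>n. e (\<sigma> n)) \<longlonglongrightarrow> 0" using LIMSEQ_subseq_LIMSEQ[OF e0 \<sigma>] by (simp add: o_def)
      show "\<forall>\<^sub>F n in sequentially. dist (p (\<sigma> n)) x0 \<le> dist (e (\<sigma> n)) 0"
      proof (rule always_eventually, rule allI)
        fix n show "dist (p (\<sigma> n)) x0 \<le> dist (e (\<sigma> n)) 0"
          using px0[of "\<sigma> n"] e(1)[of "\<sigma> n"] by (simp add: dist_real_def)
      qed
    qed
    moreover have "(\<lambda>n. p (\<sigma> n)) \<longlonglongrightarrow> x 0" using Xlim[of 0] T(1) by (simp add: X0)
    ultimately show ?thesis using LIMSEQ_unique by blast
  qed
  have xD: "x s \<in> D" if s: "s \<in> {0..T}" for s
  proof -
    \<comment> \<open>\<open>D\<close> need not be closed. Nodes within \<open>r / 2\<close> of a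
      polygon are within \<open>r\<close> of \<open>x0\<close>, so their limit is taken in the
      compact set \<open>D \<inter> cball x0 r\<close>.\<close>
    obtain N where N: "\<And>n. n \<ge> N \<Longrightarrow> e n < r / 2 / (c + 2)"
      using order_tendstoD(2)[OF e0, of "r / 2 / (c + 2)"] r(1) c(1) unfolding eventually_sequentially by auto
    have "P (\<sigma> n) s \<in> D \<inter> cball x0 r" if "N \<le> n" for n
    proof -
      have "e (\<sigma> n) < r / 2 / (c + 2)" using N[of "\<sigma> n"] \<sigma>n[of n] that by simp
      then have "(c + 2) * e (\<sigma> n) < r / 2" using c(1) by (simp add: pos_less_divide_eq algebra_simps)
      then have "dist (P (\<sigma> n) s) x0 \<le> r"
        using lab[of s "\<sigma> n"] s Xx0[OF s, of "\<sigma> n"] dist_triangle[of "P (\<sigma> n) s" x0 "X (\<sigma> n) s"] by simp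
      moreover have "P (\<sigma> n) s \<in> D"
        using lab[of s "\<sigma> n"] s green_subset[OF assms(4)[of "Suc (\<sigma> n)"]] by auto
      ultimately show ?thesis by (simp add: dist_commute)
    qed
    then have "\<forall>\<^sub>F n in sequentially. P (\<sigma> n) s \<in> D \<inter> cball x0 r" unfolding eventually_sequentially by blast
    then show ?thesis
      using Lim_in_closed_set[OF compact_imp_closed[OF r(2)] _ sequentially_bot Plim[OF s]] by blast
  qed
  have below: "\<exists>N. \<forall>n\<ge>N. k \<le> Suc (\<sigma> n)" for k
    using \<sigma>n by (intro exI[of _ k]) (meson le_SucI le_trans)
  \<comment> \<open>The same nodes, read at a coarser level: the fine green set lies in the coarse
    one, and the fine mapping is contained in the coarse mapping on its closure.\<close>
  have labk: "P (\<sigma> n) s \<in> \<Union>(Green (A k)) \<and> Y (\<sigma> n) s \<in> green_of (A k) (P (\<sigma> n) s) \<and>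
       V (\<sigma> n) s \<in> green_map (A k) (green_of (A k) (P (\<sigma> n) s)) (Y (\<sigma> n) s)"
    if k: "1 \<le> k" "k \<le> Suc (\<sigma> n)" and s: "s \<in> {0..T}" for k n s
  proof -
    note l = lab[of s "\<sigma> n"]
    have "P (\<sigma> n) s \<in> \<Union>(Green (A (Suc (\<sigma> n))))" and Y1: "Y (\<sigma> n) s \<in> green_of (A (Suc (\<sigma> n))) (P (\<sigma> n) s)"
      and V1: "V (\<sigma> n) s \<in> green_map (A (Suc (\<sigma> n))) (green_of (A (Suc (\<sigma> n))) (P (\<sigma> n) s)) (Y (\<sigma> n) s)"
      using l s by simp_all
    with ref[OF k, unfolded green_refines_def, THEN conjunct1, rule_format, OF this(1)]
    show ?thesis using closure_subset by blast
  qed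
  have xG: "x t \<in> \<Union>(Green (A k))" if k: "1 \<le> k" and t: "0 < t" "t \<le> T" for k t
  proof -
    have tT: "t \<in> {0..T}" using t by simp
    obtain N where N: "\<forall>n\<ge>N. k \<le> Suc (\<sigma> n)" using below by blast
    have PD: "P (\<sigma> n) t \<in> D" for n
      using lab[of t "\<sigma> n"] t green_subset[OF assms(4)[of "Suc (\<sigma> n)"]] by auto
    have "(\<lambda>n. w k (P (\<sigma> n) t)) \<longlonglongrightarrow> w k (x t)"
      by (rule continuous_on_tendsto_compose[OF quasi_Lyapunov_continuous[OF assms(6)[OF k]] Plim[OF tT] xD[OF tT]])
        (simp add: PD)
    \<comment> \<open>The estimate holds for the functions of the finer levels, which change with n.
      Their monotonicity transfers it to the fixed \<open>w k\<close>, whose continuity then allows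
      the limit.\<close>
    moreover have "\<exists>N. \<forall>n\<ge>N. t / 2 \<le> w k (P (\<sigma> n) t)"
    proof (intro exI allI impI)
      fix n assume "N \<le> n"
      then have "w (Suc (\<sigma> n)) (P (\<sigma> n) t) \<le> w k (P (\<sigma> n) t)" using assms(7)[OF k _ PD] N by blast
      then show "t / 2 \<le> w k (P (\<sigma> n) t)" using lab[of t "\<sigma> n"] t by simp
    qed
    ultimately have "t / 2 \<le> w k (x t)" by (rule LIMSEQ_le_const)
    then show ?thesis using quasi_Lyapunov_pos_iff[OF assms(6)[OF k] xD[OF tT]] t by simp
  qed
  have near: "negligible {t\<in>{0<..<T}. \<exists>v. (x has_vector_derivative v) (at t) \<and> \<not> (\<exists>u\<in>F (x t). dist v u \<le> 1 / real k)}"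
    if k: "1 \<le> k" for k
  proof -
    \<comment> \<open>Only polygons built at a level at least k can be read at level k; shifting the
      sequence by \<open>N\<close> discards the others.\<close>
    obtain N where N: "\<forall>n\<ge>N. k \<le> Suc (\<sigma> n)" using below by blast
    show ?thesis
    proof (rule velocity_near_values_ae[OF assms(4)[OF k] x, of "\<lambda>n. X (\<sigma> (n + N))" "\<lambda>n. P (\<sigma> (n + N))"
          "\<lambda>n. Y (\<sigma> (n + N))" "\<lambda>n. e (\<sigma> (n + N))" "\<lambda>n. V (\<sigma> (n + N))"])
      show "x t \<in> \<Union>(Green (A k))" if "0 < t" "t < T" for t using xG[OF k] that by simp
      show "\<exists>M. \<forall>n\<ge>M. \<forall>s\<in>{0..T}. dist (X (\<sigma> (n + N)) s) (x s) < \<eta> \<and> dist (P (\<sigma> (n + N)) s) (x s) < \<eta> \<and>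
          dist (Y (\<sigma> (n + N)) s) (x s) < \<eta> \<and> e (\<sigma> (n + N)) < \<eta>" if "0 < \<eta>" for \<eta>
        using conv[OF that] by (meson trans_le_add1)
      show "P (\<sigma> (n + N)) s \<in> \<Union>(Green (A k)) \<and> Y (\<sigma> (n + N)) s \<in> green_of (A k) (P (\<sigma> (n + N)) s) \<and>
         V (\<sigma> (n + N)) s \<in> green_map (A k) (green_of (A k) (P (\<sigma> (n + N)) s)) (Y (\<sigma> (n + N)) s)" if "s \<in> {0..T}" for n s
        by (rule labk[OF k _ that]) (simp add: N)
      show "green_le (A k) (P (\<sigma> (n + N)) s) (P (\<sigma> (n + N)) s')" if s: "0 \<le> s" "s \<le> s'" "s' \<le> T" for n s s'
      proof -
        have kn: "k \<le> Suc (\<sigma> (n + N))" using N by simp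
        show ?thesis
          using ref[OF k kn, unfolded green_refines_def, THEN conjunct2, rule_format, OF _ _ le[OF s]]
            lab[of s "\<sigma> (n + N)"] lab[of s' "\<sigma> (n + N)"] s by simp
      qed
    qed (rule slope)
  qed
  \<comment> \<open>A constant extension beyond both ends, Lipschitz on the whole line, as the
    differentiability lemma requires.\<close>
  define x' where "x' t = x (max 0 (min t T))" for t
  have "negligible {t. \<not> x' differentiable (at t)}"
  proof (rule Lipschitz_differentiable_ae[OF lipschitz_onI])
    fix s t
    have "dist (x' s) (x' t) \<le> (c + 2) * \<bar>max 0 (min s T) - max 0 (min t T)\<bar>"
      unfolding x'_def dist_norm by (rule xlip) (use T(1) in auto)
    also have "\<dots> \<le> (c + 2) * dist s t"
      using c(1) by (intro mult_left_mono) (auto simp: dist_real_def)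
    finally show "dist (x' s) (x' t) \<le> (c + 2) * dist s t" .
  qed (use c(1) in simp)
  \<comment> \<open>One null set for all k at once. Off it the derivative is within
    \<open>1 / k\<close> of \<open>F (x t)\<close> for every k, hence in this closed set.\<close>
  then have "negligible ({t. \<not> x' differentiable (at t)} \<union> {0, T} \<union>
    (\<Union>k\<in>{1..}. {t\<in>{0<..<T}. \<exists>v. (x has_vector_derivative v) (at t) \<and> \<not> (\<exists>u\<in>F (x t). dist v u \<le> 1 / real k)}))"
    (is "negligible ?Z")
    by (intro negligible_Un negligible_countable_Union) (use near in auto)
  have good: "\<exists>v. (x has_vector_derivative v) (at t within {0..T}) \<and> v \<in> F (x t)" if t: "t \<in> {0..T}" "t \<notin> ?Z" for t
  proof -
    have t': "t \<in> {0<..<T}" using t by auto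
    have "x' differentiable (at t)" using t by blast
    then obtain v where "(x' has_vector_derivative v) (at t)"
      using vector_derivative_works by blast
    then have v: "(x has_vector_derivative v) (at t)"
      by (rule has_vector_derivative_transform_within_open[OF _ open_greaterThanLessThan t']) (auto simp: x'_def)
    have "\<exists>u\<in>F (x t). dist v u \<le> 1 / real k" if "1 \<le> k" for k
      using t t' v that by blast
    have "v \<in> closure (F (x t))"
      unfolding closure_approachable
    proof (intro allI impI)
      fix \<eta> :: real assume "0 < \<eta>"
      then obtain n where "inverse (real (Suc n)) < \<eta>" using reals_Archimedean by blast
      moreover obtain u where "u \<in> F (x t)" "dist v u \<le> 1 / real (Suc n)"
        using \<open>\<And>k. 1 \<le> k \<Longrightarrow> \<exists>u\<in>F (x t). dist v u \<le> 1 / real k\<close>[of "Suc n"] by auto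
      ultimately show "\<exists>u\<in>F (x t). dist u v < \<eta>"
        by (intro bexI[of _ u]) (simp_all add: dist_commute inverse_eq_divide)
    qed
    moreover have "x t \<in> closure D" using xD t closure_subset by blast
    ultimately have "v \<in> F (x t)" using assms(3) by simp
    then show ?thesis using has_vector_derivative_at_within[OF v] by blast
  qed
  show ?thesis
  proof (intro exI[of _ T] exI[of _ x] conjI)
    show "x ` {0..T} \<subseteq> D" using xD by blast
    show "absolutely_continuous_on_interval 0 T x"
    proof (rule Lipschitz_imp_absolutely_continuous_on_interval[of _ _ _ "c + 2"])
      show "dist (x s) (x t) \<le> (c + 2) * (t - s)" if "0 \<le> s" "s \<le> t" "t \<le> T" for s t
        using xlip[of s t] that by (simp add: dist_norm norm_minus_commute)
    qed (use c(1) in simp)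
    have "AE t in lebesgue. t \<notin> ?Z"
      using \<open>negligible ?Z\<close> unfolding negligible_iff_null_sets by (rule AE_not_in)
    then have "AE t in lebesgue. t \<in> {0..T} \<longrightarrow>
        (\<exists>v. (x has_vector_derivative v) (at t within {0..T}) \<and> v \<in> F (x t))"
      by eventually_elim (use good in blast)
    then show "AE t in lebesgue_on {0..T}.
        \<exists>v. (x has_vector_derivative v) (at t within {0..T}) \<and> v \<in> F (x t)"
      by (simp add: AE_restrict_space_iff)
  qed (use T(1) \<open>x 0 = x0\<close> in auto)
qed

end
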